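(* Let $\mathcal T,\mathcal A:\mathbb R L_2^{m,n}[a,b]\to\mathbb R L_2^{m,n}[a,b]$, $\mathcal B_1:\mathbb R^{n_w}\to\mathbb R L_2^{m,n}[a,b]$, $\mathcal C_1:\mathbb R L_2^{m,n}[a,b]\to\mathbb R^{n_z}$ and $\mathcal C_2:\mathbb R L_2^{m,n}[a,b]\to\mathbb R^{n_y}$ be PI operators and let $D_{21}\in\mathbb R^{n_y\times n_w}$. Suppose there exist $\epsilon>0$, $\gamma>0$, a matrix $W\in\mathbb R^{n_w\times n_w}$, and PI operators $\mathcal P:\mathbb R L_2^{m,n}[a,b]\to\mathbb R L_2^{m,n}[a,b]$ with $\mathcal P\succeq\epsilon I$ and $\mathcal Z:\mathbb R^{n_y}\to\mathbb R L_2^{m,n}[a,b]$ such that $$\mathcal T^*\mathcal P\mathcal A+\mathcal A^*\mathcal P\mathcal T+\mathcal T^*\mathcal Z\mathcal C_2+\mathcal C_2^*\mathcal Z^*\mathcal T+\mathcal C_1^*\mathcal C_1\preceq 0,$$ $$\begin{bmatrix}\mathcal P&-(\mathcal P\mathcal B_1+\mathcal ZD_{21})\\-(\mathcal P\mathcal B_1+\mathcal ZD_{21})^*&W\end{bmatrix}\succeq 0,\qquad \operatorname{trace}(W)\le\gamma^2 .$$ Then, with $\mathcal L=\mathcal P^{-1}\mathcal Z$, the $H_2$-norm of $\Sigma(\mathcal T,(\mathcal A+\mathcal L\mathcal C_2),-(\mathcal B_1+\mathcal LD_{21}),\mathcal C_1,-)$ is upper bounded by $\gamma$.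
   Context: Fix a compact interval $[a,b]\subset\mathbb R$. $L_2^n[a,b]$ is the space of square-integrable $\mathbb R^n$-valued functions on $[a,b]$, and $\mathbb R L_2^{m,n}[a,b]:=\mathbb R^m\times L_2^n[a,b]$ with inner product $\langle (x_1,\mathbf x_2),(y_1,\mathbf y_2)\rangle_{\mathbb R L_2}:=x_1^Ty_1+\langle\mathbf x_2,\mathbf y_2\rangle_{L_2}$. $\mathcal A^*$ denotes the Hilbert space adjoint; $\succeq,\preceq$ denote the usual (Loewner) order on self-adjoint bounded operators, so $\mathcal P\succeq\epsilon I$ means $\mathcal P=\mathcal P^*$ and $\mathcal P-\epsilon I$ is positive semidefinite. The block operator in the claim acts on $\mathbb R L_2^{m,n}[a,b]\times\mathbb R^{n_w}$. For signals, $\|\cdot\|_{L_2}$ is the norm of $L_2[0,\infty)$. $L_{2e}[\mathbb R^+]$ is the extended space of signals on $\mathbb R^+=[0,\infty)$ whose truncation to $[0,T]$ is square-integrable for every $T$. PI operators: a bounded linear operator $\mathcal P:\mathbb R L_2^{m_1,n_1}[a,b]\to\mathbb R L_2^{m_2,n_2}[a,b]$ is a PI (Partial Integral) operator if there exist a real matrix $P$ and matrix-valued polynomials $Q_1,Q_2,R_0,R_1,R_2$ of compatible dimensions such that $$\mathcal P\begin{bmatrix}x\\ \mathbf y\end{bmatrix}(s)=\begin{bmatrix}Px+\int_a^bQ_1(s)\mathbf y(s)\,ds\\ Q_2(s)x+(\mathcal R\mathbf y)(s)\end{bmatrix},\quad (\mathcal R\mathbf y)(s)=R_0(s)\mathbf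 y(s)+\int_a^sR_1(s,\theta)\mathbf y(\theta)\,d\theta+\int_s^bR_2(s,\theta)\mathbf y(\theta)\,d\theta .$$ Any of the dimensions may be zero, in which case the corresponding parameters are absent (so operators from or into some $\mathbb R^k$ are included). PIE systems: given operators $\mathcal T,\mathcal A,\mathcal B,\mathcal C$ (PI operators, or bounded linear operators such as those built from $\mathcal P^{-1}$) and a matrix $D$, $\{\mathbf x,z\}$ satisfies the system $\Sigma(\mathcal T,\mathcal A,\mathcal B,\mathcal C,D)$ for initial condition $\mathbf x_0\in\mathbb R L_2$ and input $w\in L_{2e}[\mathbb R^+]$ if $\mathbf x(t)\in\mathbb R L_2$ for $t\in\mathbb R^+$, $\mathcal T\mathbf x$ is differentiable for all $t\in\mathbb R^+$, $z\in L_{2e}[\mathbb R^+]$, $(\mathcal T\mathbf x)(0)=\mathbf x_0$, and for all $t\in\mathbb R^+$ $$\mathcal T\dot{\mathbf x}(t)=\mathcal A\mathbf x(t)+\mathcal B w(t),\qquad z(t)=\mathcal C\mathbf x(t)+Dw(t),$$ where $\mathcal T\dot{\mathbf x}(t)$ means $\partial_t(\mathcal T\mathbf x(t))$. A dash "$-$" in place of a parameter means that this parameter is zero. $H_2$-norm: for $\Sigma(\mathcal T,\mathcal A,\mathcal B,\mathcal C,-)$ with $\mathcal B$ defined on $\mathbb R^q$, suppose that for every $u_0\in\mathbb R^q$ the system has a solution for initial condition $\mathcal Bu_0$ (i.e. $\mathcal T\mathbf x(0)=\mathcal Bu_0$) and zero input (this is part of the definition of the $H_2$-norm). The $H_2$-norm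 is $$\sup_{\|u_0\|=1}\left\{\|z\|_{L_2}\ :\ \{\mathbf x,z\}\text{ satisfies }\Sigma(\mathcal T,\mathcal A,\mathcal B,\mathcal C,-)\text{ for initial condition }\mathcal Bu_0\text{ and zero input},\ u_0\in\mathbb R^q\right\}.$$ The system in the claim is the estimation error system $\mathcal T\dot{\mathbf e}=(\mathcal A+\mathcal L\mathcal C_2)\mathbf e-(\mathcal B_1+\mathcal LD_{21})w$ with output $\mathcal C_1\mathbf e$, for the plant $\mathcal T\dot{\mathbf x}=\mathcal A\mathbf x+\mathcal B_1w$, $z=\mathcal C_1\mathbf x$, $y=\mathcal C_2\mathbf x+D_{21}w$ and a Luenberger observer with gain $\mathcal L$. *)

theory Defs
  imports
    "HOL-Analysis.Analysis"
    "HOL-Computational_Algebra.Polynomial"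
    "Jordan_Normal_Form.Matrix"
begin

section \<open>Real vectors and matrices whose dimensions may be zero\<close>

text \<open>Dimensions are natural numbers and may be 0, which a type-indexed \<open>real ^ 'n\<close> does not allow.\<close>

type_synonym rvec = "real Matrix.vec"
type_synonym rmat = "real Matrix.mat"

definition mat_trace :: "rmat \<Rightarrow> real" where
  "mat_trace W = (\<Sum>i<dim_row W. W $$ (i, i))"

section \<open>Hilbert spaces given by representatives, and their operators\<close>

text \<open>
  The library has no space $L_2$ of equivalence classes. A space is therefore given by a carrier of
  representatives, the linear operations, and a positive semidefinite form; the Hilbert space meant
  is the quotient by the null vectors of the form. Equality in that quotient is \<open>heq\<close> below, and it
  takes the place of \<open>=\<close> wherever elements of the space are compared. For \<open>RL2\<close> this is
  equality almost everywhere (lemma \<open>heq_RL2_iff\<close>), for \<open>Rn\<close> it is equality.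
\<close>

record 'h hspace =
  hcarrier :: "'h set"
  hzero :: 'h
  hadd :: "'h \<Rightarrow> 'h \<Rightarrow> 'h"
  hscale :: "real \<Rightarrow> 'h \<Rightarrow> 'h"
  hinner :: "'h \<Rightarrow> 'h \<Rightarrow> real"

definition hminus :: "'h hspace \<Rightarrow> 'h \<Rightarrow> 'h \<Rightarrow> 'h" where
  "hminus H x y = hadd H x (hscale H (- 1) y)"

definition hnorm :: "'h hspace \<Rightarrow> 'h \<Rightarrow> real" where
  "hnorm H x = sqrt (hinner H x x)"

definition heq :: "'h hspace \<Rightarrow> 'h \<Rightarrow> 'h \<Rightarrow> bool" where
  "heq H x y \<longleftrightarrow> hnorm H (hminus H x y) = 0"

text \<open>Linearity and boundedness together make \<open>F\<close> compatible with \<open>heq\<close>.\<close>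

definition bounded_op :: "'h hspace \<Rightarrow> 'k hspace \<Rightarrow> ('h \<Rightarrow> 'k) \<Rightarrow> bool" where
  "bounded_op H K F \<longleftrightarrow>
     (\<forall>x\<in>hcarrier H. F x \<in> hcarrier K) \<and>
     (\<forall>x\<in>hcarrier H. \<forall>y\<in>hcarrier H. heq K (F (hadd H x y)) (hadd K (F x) (F y))) \<and>
     (\<forall>c. \<forall>x\<in>hcarrier H. heq K (F (hscale H c x)) (hscale K c (F x))) \<and>
     (\<exists>M. \<forall>x\<in>hcarrier H. hnorm K (F x) \<le> M * hnorm H x)"

definition op_eq :: "'h hspace \<Rightarrow> 'k hspace \<Rightarrow> ('h \<Rightarrow> 'k) \<Rightarrow> ('h \<Rightarrow> 'k) \<Rightarrow> bool" where
  "op_eq H K F G \<longleftrightarrow> (\<forall>x\<in>hcarrier H. heq K (F x) (G x))"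

definition op_add :: "('h \<Rightarrow> 'k) \<Rightarrow> 'k hspace \<Rightarrow> ('h \<Rightarrow> 'k) \<Rightarrow> 'h \<Rightarrow> 'k"
    (\<open>(_ \<boxplus>\<^bsub>_\<^esub> _)\<close> [50, 0, 51] 50) where
  "F \<boxplus>\<^bsub>K\<^esub> G = (\<lambda>x. hadd K (F x) (G x))"

definition op_scale :: "'k hspace \<Rightarrow> real \<Rightarrow> ('h \<Rightarrow> 'k) \<Rightarrow> 'h \<Rightarrow> 'k" where
  "op_scale K c F = (\<lambda>x. hscale K c (F x))"

definition op_neg :: "'k hspace \<Rightarrow> ('h \<Rightarrow> 'k) \<Rightarrow> 'h \<Rightarrow> 'k" where
  "op_neg K F = op_scale K (- 1) F"

definition op_zero :: "'k hspace \<Rightarrow> 'h \<Rightarrow> 'k" where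
  "op_zero K = (\<lambda>x. hzero K)"

text \<open>Where they exist, adjoint and inverse are unique up to \<open>op_eq\<close>, so the choice is immaterial.\<close>

definition adj :: "'h hspace \<Rightarrow> 'k hspace \<Rightarrow> ('h \<Rightarrow> 'k) \<Rightarrow> 'k \<Rightarrow> 'h" where
  "adj H K F = (SOME G. bounded_op K H G \<and>
     (\<forall>x\<in>hcarrier H. \<forall>y\<in>hcarrier K. hinner K (F x) y = hinner H x (G y)))"

definition op_inv :: "'h hspace \<Rightarrow> ('h \<Rightarrow> 'h) \<Rightarrow> 'h \<Rightarrow> 'h" where
  "op_inv H F = (SOME G. bounded_op H H G \<and> op_eq H H (F \<circ> G) id \<and> op_eq H H (G \<circ> F) id)"

definition selfadjoint_op :: "'h hspace \<Rightarrow> ('h \<Rightarrow> 'h) \<Rightarrow> bool" where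
  "selfadjoint_op H F \<longleftrightarrow> bounded_op H H F \<and> op_eq H H F (adj H H F)"

definition psd_op :: "'h hspace \<Rightarrow> ('h \<Rightarrow> 'h) \<Rightarrow> bool" where
  "psd_op H F \<longleftrightarrow> selfadjoint_op H F \<and> (\<forall>x\<in>hcarrier H. 0 \<le> hinner H x (F x))"

definition loewner_le :: "'h hspace \<Rightarrow> ('h \<Rightarrow> 'h) \<Rightarrow> ('h \<Rightarrow> 'h) \<Rightarrow> bool" where
  "loewner_le H F G \<longleftrightarrow> selfadjoint_op H F \<and> selfadjoint_op H G \<and> psd_op H (G \<boxplus>\<^bsub>H\<^esub> op_neg H F)"

definition prod_hspace :: "'h hspace \<Rightarrow> 'k hspace \<Rightarrow> ('h \<times> 'k) hspace" where
  "prod_hspace H K =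
     \<lparr> hcarrier = hcarrier H \<times> hcarrier K,
       hzero = (hzero H, hzero K),
       hadd = (\<lambda>x y. (hadd H (fst x) (fst y), hadd K (snd x) (snd y))),
       hscale = (\<lambda>c x. (hscale H c (fst x), hscale K c (snd x))),
       hinner = (\<lambda>x y. hinner H (fst x) (fst y) + hinner K (snd x) (snd y)) \<rparr>"

definition block_op :: "'h hspace \<Rightarrow> 'k hspace \<Rightarrow> ('h \<Rightarrow> 'h) \<Rightarrow> ('k \<Rightarrow> 'h) \<Rightarrow> ('h \<Rightarrow> 'k) \<Rightarrow> ('k \<Rightarrow> 'k)
    \<Rightarrow> 'h \<times> 'k \<Rightarrow> 'h \<times> 'k" where
  "block_op H K F11 F12 F21 F22 =
     (\<lambda>(x, u). (hadd H (F11 x) (F12 u), hadd K (F21 x) (F22 u)))"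

section \<open>The spaces $R^k$, $L_2^n[a,b]$ and $RL_2^{m,n}[a,b]$\<close>

definition Rn :: "nat \<Rightarrow> rvec hspace" where
  "Rn k = \<lparr> hcarrier = carrier_vec k, hzero = 0\<^sub>v k, hadd = (+), hscale = (\<cdot>\<^sub>v),
            hinner = scalar_prod \<rparr>"

definition L2 :: "real \<Rightarrow> real \<Rightarrow> nat \<Rightarrow> (real \<Rightarrow> rvec) set" where
  "L2 a b n = {f. (\<forall>s\<in>{a..b}. f s \<in> carrier_vec n) \<and>
     (\<forall>i<n. (\<lambda>s. vec_index (f s) i) \<in> borel_measurable (lebesgue_on {a..b}) \<and>
            integrable (lebesgue_on {a..b}) (\<lambda>s. (vec_index (f s) i)\<^sup>2))}"

type_synonym rl2 = "rvec \<times> (real \<Rightarrow> rvec)"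

definition RL2 :: "real \<Rightarrow> real \<Rightarrow> nat \<Rightarrow> nat \<Rightarrow> rl2 hspace" where
  "RL2 a b m n =
     \<lparr> hcarrier = carrier_vec m \<times> L2 a b n,
       hzero = (0\<^sub>v m, \<lambda>s. 0\<^sub>v n),
       hadd = (\<lambda>x y. (fst x + fst y, \<lambda>s. snd x s + snd y s)),
       hscale = (\<lambda>c x. (c \<cdot>\<^sub>v fst x, \<lambda>s. c \<cdot>\<^sub>v snd x s)),
       hinner = (\<lambda>x y. scalar_prod (fst x) (fst y) +
                       (\<integral>s. scalar_prod (snd x s) (snd y s) \<partial>lebesgue_on {a..b})) \<rparr>"

lemma scalar_prod_diff_eq_0_iff:
  fixes u v :: rvec
  assumes "u \<in> carrier_vec k" "v \<in> carrier_vec k"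
  shows "scalar_prod (u + (- 1) \<cdot>\<^sub>v v) (u + (- 1) \<cdot>\<^sub>v v) = 0 \<longleftrightarrow> u = v"
proof -
  have dim: "dim_vec u = k" "dim_vec v = k"
    using assms by auto
  have "scalar_prod (u + (- 1) \<cdot>\<^sub>v v) (u + (- 1) \<cdot>\<^sub>v v)
      = (\<Sum>i<k. (vec_index u i - vec_index v i)\<^sup>2)"
    by (simp add: scalar_prod_def dim power2_eq_square atLeast0LessThan)
  also have "\<dots> = 0 \<longleftrightarrow> (\<forall>i\<in>{..<k}. (vec_index u i - vec_index v i)\<^sup>2 = 0)"
    by (rule sum_nonneg_eq_0_iff) simp_all
  also have "\<dots> \<longleftrightarrow> u = v"
    by (auto simp: Matrix.vec_eq_iff dim)
  finally show ?thesis .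
qed

lemma heq_Rn_iff:
  assumes "u \<in> carrier_vec k" "v \<in> carrier_vec k"
  shows "heq (Rn k) u v \<longleftrightarrow> u = v"
  unfolding heq_def hnorm_def hminus_def Rn_def
  using scalar_prod_diff_eq_0_iff[OF assms] by simp

lemma L2_integrable_inner_diff:
  assumes f: "f \<in> L2 a b n" and g: "g \<in> L2 a b n"
  shows "integrable (lebesgue_on {a..b})
    (\<lambda>s. scalar_prod (f s + (- 1) \<cdot>\<^sub>v g s) (f s + (- 1) \<cdot>\<^sub>v g s))"
proof -
  let ?M = "lebesgue_on {a..b}"
  have "integrable ?M (\<lambda>s. (vec_index (f s) i - vec_index (g s) i)\<^sup>2)" if i: "i < n" for i
  proof (rule Bochner_Integration.integrable_bound)
    show "integrable ?M (\<lambda>s. 2 * (vec_index (f s) i)\<^sup>2 + 2 * (vec_index (g s) i)\<^sup>2)"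
      using f g i by (auto simp: L2_def)
    show "(\<lambda>s. (vec_index (f s) i - vec_index (g s) i)\<^sup>2) \<in> borel_measurable ?M"
      using f g i by (intro borel_measurable_power borel_measurable_diff) (auto simp: L2_def)
    have "(x - y)\<^sup>2 \<le> 2 * x\<^sup>2 + 2 * y\<^sup>2" for x y :: real
      using sum_squares_bound[of x "- y"] by (simp add: power2_diff)
    then show "AE s in ?M. norm ((vec_index (f s) i - vec_index (g s) i)\<^sup>2)
        \<le> norm (2 * (vec_index (f s) i)\<^sup>2 + 2 * (vec_index (g s) i)\<^sup>2)"
      by auto
  qed
  then have "integrable ?M (\<lambda>s. \<Sum>i<n. (vec_index (f s) i - vec_index (g s) i)\<^sup>2)"
    by auto
  moreover have "scalar_prod (f s + (- 1) \<cdot>\<^sub>v g s) (f s + (- 1) \<cdot>\<^sub>v g s)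
      = (\<Sum>i<n. (vec_index (f s) i - vec_index (g s) i)\<^sup>2)" if "s \<in> {a..b}" for s
  proof -
    have "f s \<in> carrier_vec n" "g s \<in> carrier_vec n"
      using f g that by (auto simp: L2_def)
    then have "dim_vec (f s) = n" "dim_vec (g s) = n"
      by auto
    then show ?thesis
      by (simp add: scalar_prod_def power2_eq_square atLeast0LessThan)
  qed
  then have "integrable ?M (\<lambda>s. scalar_prod (f s + (- 1) \<cdot>\<^sub>v g s) (f s + (- 1) \<cdot>\<^sub>v g s))
      \<longleftrightarrow> integrable ?M (\<lambda>s. \<Sum>i<n. (vec_index (f s) i - vec_index (g s) i)\<^sup>2)"
    by (intro Bochner_Integration.integrable_cong) auto
  ultimately show ?thesis
    by blast
qed

lemma heq_RL2_iff:
  assumes x: "x \<in> hcarrier (RL2 a b m n)" and y: "y \<in> hcarrier (RL2 a b m n)"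
  shows "heq (RL2 a b m n) x y \<longleftrightarrow>
    fst x = fst y \<and> (AE s in lebesgue_on {a..b}. snd x s = snd y s)"
proof -
  let ?M = "lebesgue_on {a..b}"
  define u where "u = fst x + (- 1) \<cdot>\<^sub>v fst y"
  define d where "d s = snd x s + (- 1) \<cdot>\<^sub>v snd y s" for s
  have carr: "fst x \<in> carrier_vec m" "fst y \<in> carrier_vec m" "snd x \<in> L2 a b n" "snd y \<in> L2 a b n"
    using x y by (auto simp: RL2_def)
  have int: "integrable ?M (\<lambda>s. scalar_prod (d s) (d s))"
    unfolding d_def by (rule L2_integrable_inner_diff[OF carr(3,4)])
  have nonneg: "scalar_prod v v \<ge> 0" for v :: rvec
    by (auto simp: scalar_prod_def intro!: sum_nonneg)
  have dim: "snd x s \<in> carrier_vec n" "snd y s \<in> carrier_vec n" if "s \<in> {a..b}" for s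
    using carr that by (auto simp: L2_def)
  have d0: "scalar_prod (d s) (d s) = 0 \<longleftrightarrow> snd x s = snd y s" if "s \<in> {a..b}" for s
    unfolding d_def by (rule scalar_prod_diff_eq_0_iff[OF dim(1)[OF that] dim(2)[OF that]])
  have u0: "scalar_prod u u = 0 \<longleftrightarrow> fst x = fst y"
    unfolding u_def by (rule scalar_prod_diff_eq_0_iff[OF carr(1,2)])
  have "heq (RL2 a b m n) x y \<longleftrightarrow> scalar_prod u u + (\<integral>s. scalar_prod (d s) (d s) \<partial>?M) = 0"
    by (simp add: heq_def hnorm_def hminus_def RL2_def u_def d_def)
  also have "\<dots> \<longleftrightarrow> scalar_prod u u = 0 \<and> (\<integral>s. scalar_prod (d s) (d s) \<partial>?M) = 0"
    using nonneg by (simp add: add_nonneg_eq_0_iff)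
  also have "(\<integral>s. scalar_prod (d s) (d s) \<partial>?M) = 0 \<longleftrightarrow> (AE s in ?M. scalar_prod (d s) (d s) = 0)"
    using int nonneg by (intro integral_nonneg_eq_0_iff_AE) auto
  also have "\<dots> \<longleftrightarrow> (AE s in ?M. snd x s = snd y s)"
    using d0 by (intro AE_cong) auto
  finally show ?thesis using u0 by simp
qed

section \<open>PI operators\<close>

definition vint :: "nat \<Rightarrow> real \<Rightarrow> real \<Rightarrow> (real \<Rightarrow> rvec) \<Rightarrow> rvec" where
  "vint k c d f = Matrix.vec k (\<lambda>i. \<integral>s. vec_index (f s) i \<partial>lebesgue_on {c..d})"

definition mpoly1 :: "real poly mat \<Rightarrow> real \<Rightarrow> rmat" where
  "mpoly1 Q s = map_mat (\<lambda>p. poly p s) Q"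

text \<open>A polynomial in two variables is a polynomial in \<open>s\<close> whose coefficients are polynomials
  in \<open>\<theta>\<close>.\<close>

definition mpoly2 :: "real poly poly mat \<Rightarrow> real \<Rightarrow> real \<Rightarrow> rmat" where
  "mpoly2 R s \<theta> = map_mat (\<lambda>p. poly (poly p [:s:]) \<theta>) R"

definition PI_map :: "real \<Rightarrow> real \<Rightarrow> nat \<Rightarrow> nat \<Rightarrow> rmat \<Rightarrow> real poly mat \<Rightarrow> real poly mat \<Rightarrow>
    real poly mat \<Rightarrow> real poly poly mat \<Rightarrow> real poly poly mat \<Rightarrow> rl2 \<Rightarrow> rl2" where
  "PI_map a b m2 n2 P Q1 Q2 R0 R1 R2 = (\<lambda>(x, y).
     (P *\<^sub>v x + vint m2 a b (\<lambda>s. mpoly1 Q1 s *\<^sub>v y s),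
      \<lambda>s. mpoly1 Q2 s *\<^sub>v x +
          (mpoly1 R0 s *\<^sub>v y s
           + vint n2 a s (\<lambda>\<theta>. mpoly2 R1 s \<theta> *\<^sub>v y \<theta>)
           + vint n2 s b (\<lambda>\<theta>. mpoly2 R2 s \<theta> *\<^sub>v y \<theta>))))"

definition PI_op :: "real \<Rightarrow> real \<Rightarrow> nat \<Rightarrow> nat \<Rightarrow> nat \<Rightarrow> nat \<Rightarrow> (rl2 \<Rightarrow> rl2) \<Rightarrow> bool" where
  "PI_op a b m1 n1 m2 n2 F \<longleftrightarrow>
     bounded_op (RL2 a b m1 n1) (RL2 a b m2 n2) F \<and>
     (\<exists>P\<in>carrier_mat m2 m1. \<exists>Q1\<in>carrier_mat m2 n1. \<exists>Q2\<in>carrier_mat n2 m1.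
      \<exists>R0\<in>carrier_mat n2 n1. \<exists>R1\<in>carrier_mat n2 n1. \<exists>R2\<in>carrier_mat n2 n1.
        op_eq (RL2 a b m1 n1) (RL2 a b m2 n2) F (PI_map a b m2 n2 P Q1 Q2 R0 R1 R2))"

text \<open>Operators from or into $R^k$ are the case $n = 0$, under the identification of $R^k$ with
  $RL_2^{k,0}[a,b]$.\<close>

definition PI_op_from_Rn :: "real \<Rightarrow> real \<Rightarrow> nat \<Rightarrow> nat \<Rightarrow> nat \<Rightarrow> (rvec \<Rightarrow> rl2) \<Rightarrow> bool" where
  "PI_op_from_Rn a b k m n F \<longleftrightarrow> PI_op a b k 0 m n (\<lambda>x. F (fst x))"

definition PI_op_to_Rn :: "real \<Rightarrow> real \<Rightarrow> nat \<Rightarrow> nat \<Rightarrow> nat \<Rightarrow> (rl2 \<Rightarrow> rvec) \<Rightarrow> bool" where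
  "PI_op_to_Rn a b m n k F \<longleftrightarrow> PI_op a b m n k 0 (\<lambda>x. (F x, \<lambda>s. 0\<^sub>v 0))"

section \<open>PIE systems and the $H_2$-norm\<close>

definition L2e :: "nat \<Rightarrow> (real \<Rightarrow> rvec) set" where
  "L2e k = {w. \<forall>T\<ge>0. w \<in> L2 0 T k}"

definition L2_norm :: "(real \<Rightarrow> rvec) \<Rightarrow> ennreal" where
  "L2_norm z =
     (if integrable (lebesgue_on {0..}) (\<lambda>t. scalar_prod (z t) (z t))
      then ennreal (sqrt (\<integral>t. scalar_prod (z t) (z t) \<partial>lebesgue_on {0..}))
      else \<infinity>)"

text \<open>Differentiability on $[0,\infty)$ in the norm of the space, one-sided at 0.\<close>

definition has_hderiv :: "'h hspace \<Rightarrow> (real \<Rightarrow> 'h) \<Rightarrow> 'h \<Rightarrow> real \<Rightarrow> bool" where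
  "has_hderiv H f v t \<longleftrightarrow>
     v \<in> hcarrier H \<and>
     ((\<lambda>\<tau>. hnorm H (hminus H (hscale H (1 / (\<tau> - t)) (hminus H (f \<tau>) (f t))) v)) \<longlongrightarrow> 0)
       (at t within {0..})"

definition PIE_solution :: "'h hspace \<Rightarrow> nat \<Rightarrow> nat \<Rightarrow> ('h \<Rightarrow> 'h) \<Rightarrow> ('h \<Rightarrow> 'h) \<Rightarrow> (rvec \<Rightarrow> 'h) \<Rightarrow>
    ('h \<Rightarrow> rvec) \<Rightarrow> rmat \<Rightarrow> 'h \<Rightarrow> (real \<Rightarrow> rvec) \<Rightarrow> (real \<Rightarrow> 'h) \<Rightarrow> (real \<Rightarrow> rvec) \<Rightarrow> bool" where
  "PIE_solution H q r T A B C D x0 w x z \<longleftrightarrow>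
     x0 \<in> hcarrier H \<and> w \<in> L2e q \<and> z \<in> L2e r \<and>
     (\<forall>t\<ge>0. x t \<in> hcarrier H) \<and>
     heq H (T (x 0)) x0 \<and>
     (\<forall>t\<ge>0. \<exists>v. has_hderiv H (\<lambda>\<tau>. T (x \<tau>)) v t \<and> heq H v (hadd H (A (x t)) (B (w t)))) \<and>
     (\<forall>t\<ge>0. z t = C (x t) + D *\<^sub>v w t)"

text \<open>The system $\Sigma(T, A, B, C, -)$ started at $B u_0$ with zero input.\<close>

definition impulse_solution :: "'h hspace \<Rightarrow> nat \<Rightarrow> nat \<Rightarrow> ('h \<Rightarrow> 'h) \<Rightarrow> ('h \<Rightarrow> 'h) \<Rightarrow> (rvec \<Rightarrow> 'h) \<Rightarrow>
    ('h \<Rightarrow> rvec) \<Rightarrow> rvec \<Rightarrow> (real \<Rightarrow> 'h) \<Rightarrow> (real \<Rightarrow> rvec) \<Rightarrow> bool" where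
  "impulse_solution H q r T A B C u0 x z \<longleftrightarrow>
     PIE_solution H q r T A B C (0\<^sub>m r q) (B u0) (\<lambda>t. 0\<^sub>v q) x z"

text \<open>The $H_2$-norm is only defined if every $u_0$ admits a solution.\<close>

definition H2_norm_defined :: "'h hspace \<Rightarrow> nat \<Rightarrow> nat \<Rightarrow> ('h \<Rightarrow> 'h) \<Rightarrow> ('h \<Rightarrow> 'h) \<Rightarrow> (rvec \<Rightarrow> 'h) \<Rightarrow>
    ('h \<Rightarrow> rvec) \<Rightarrow> bool" where
  "H2_norm_defined H q r T A B C \<longleftrightarrow>
     (\<forall>u0\<in>carrier_vec q. \<exists>x z. impulse_solution H q r T A B C u0 x z)"

definition H2_norm :: "'h hspace \<Rightarrow> nat \<Rightarrow> nat \<Rightarrow> ('h \<Rightarrow> 'h) \<Rightarrow> ('h \<Rightarrow> 'h) \<Rightarrow> (rvec \<Rightarrow> 'h) \<Rightarrow>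
    ('h \<Rightarrow> rvec) \<Rightarrow> ennreal" where
  "H2_norm H q r T A B C =
     Sup {L2_norm z | u0 x z. u0 \<in> carrier_vec q \<and> hnorm (Rn q) u0 = 1 \<and>
                              impulse_solution H q r T A B C u0 x z}"

end

theory Submission
  imports Defs
begin

text \<open>The weighted energy $V(t) = \langle T e(t), P\, T e(t)\rangle$ of the estimation error is a storage
  function for the error system. Since $PL = Z$, the first operator inequality, tested with $e(t)$, says
  precisely that $V' + |z|^2 \le 0$ (\<open>observer_dissipation\<close>). As $V \ge 0$, integration gives
  $\int_0^\infty |z|^2 \le V(0)$ (\<open>integral_le_of_dissipation\<close>). The initial value is $V(0) =
  \langle y, P y\rangle$ with $y = (B_1 + L D_{21}) u_0$ (the form is even in $y$), and
  $P y = G u_0$ for $G = P B_1 + Z D_{21}$. Evaluating the positive semidefinite block operator at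
  $(y, u_0)$ therefore yields $0 \le \langle u_0, W u_0\rangle - V(0)$, and a positive semidefinite
  quadratic form is at most its trace on unit vectors (\<open>psd_quadratic_form_le_trace\<close>). Together,
  $\int_0^\infty |z|^2 \le \mathrm{trace}(W) \le \gamma^2$.

  These manipulations presuppose that the adjoints and the inverse of $P$ have their defining
  properties. Both follow from Riesz representation (\<open>riesz_representation\<close>), applied to the form of
  the space for \<open>adj_exists\<close> and to the equivalent form $\langle x, P y\rangle$ for \<open>op_inv_exists\<close>.
  Riesz representation in turn rests on the completeness of the space of representatives
  (\<open>hilbert_space_RL2\<close>), that is, on the Riesz-Fischer theorem (\<open>L2_sequence_limit_real\<close>).

  Solutions are differentiable only
  in the norm of the space and only pointwise in time; \<open>has_hderiv_quadratic_form\<close> differentiates $V$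
  under this assumption.\<close>

section \<open>Semi-inner-product spaces given by representatives\<close>

text \<open>The discriminant of a nonnegative quadratic is not positive. The degenerate case \<open>q = 0\<close> is
  included because the forms below may vanish on nonzero representatives.\<close>

lemma square_le_of_nonneg_quadratic:
  fixes p q c :: real
  assumes q: "0 \<le> q" and nonneg: "\<And>t. 0 \<le> p + 2 * t * c + t\<^sup>2 * q"
  shows "c\<^sup>2 \<le> p * q"
proof (cases "q = 0")
  case True
  have "c = 0"
  proof (rule ccontr)
    assume "c \<noteq> 0"
    with nonneg[of "- (p + 1) / (2 * c)"] True show False by (simp add: field_simps)
  qed
  with True show ?thesis by simp
next
  case False
  with q have q: "0 < q" by simp
  have "0 \<le> p + 2 * (- c / q) * c + (- c / q)\<^sup>2 * q"
    by (rule nonneg)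
  also have "\<dots> = (p * q - c\<^sup>2) / q"
    using q by (simp add: field_simps power2_eq_square)
  finally show ?thesis
    using q by (simp add: zero_le_divide_iff)
qed

text \<open>Additions and scalings of representatives need not satisfy the vector space laws: functions in
  \<open>L2 a b n\<close> are unconstrained outside $[a,b]$, even in dimension. What a vector means is determined
  by its inner products with the vectors of the carrier (\<open>heq_iff_inner\<close>), so it is enough to know
  how the form acts on the operations.\<close>

locale semi_inner_space =
  fixes H :: "'h hspace"
  assumes zero_closed [simp]: "hzero H \<in> hcarrier H"
    and add_closed [simp]:
      "\<lbrakk>x \<in> hcarrier H; y \<in> hcarrier H\<rbrakk> \<Longrightarrow> hadd H x y \<in> hcarrier H"
    and scale_closed [simp]: "x \<in> hcarrier H \<Longrightarrow> hscale H c x \<in> hcarrier H"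
    and inner_commute:
      "\<lbrakk>x \<in> hcarrier H; y \<in> hcarrier H\<rbrakk> \<Longrightarrow> hinner H x y = hinner H y x"
    and inner_zero_left [simp]: "x \<in> hcarrier H \<Longrightarrow> hinner H (hzero H) x = 0"
    and inner_add_left [simp]: "\<lbrakk>x \<in> hcarrier H; y \<in> hcarrier H; z \<in> hcarrier H\<rbrakk> \<Longrightarrow>
      hinner H (hadd H x y) z = hinner H x z + hinner H y z"
    and inner_scale_left [simp]: "\<lbrakk>x \<in> hcarrier H; z \<in> hcarrier H\<rbrakk> \<Longrightarrow>
      hinner H (hscale H c x) z = c * hinner H x z"
    and inner_ge_zero [simp]: "x \<in> hcarrier H \<Longrightarrow> 0 \<le> hinner H x x"
begin

lemma inner_zero_right [simp]: "x \<in> hcarrier H \<Longrightarrow> hinner H x (hzero H) = 0"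
  by (simp add: inner_commute[of x])

lemma inner_add_right [simp]:
  "\<lbrakk>x \<in> hcarrier H; y \<in> hcarrier H; z \<in> hcarrier H\<rbrakk> \<Longrightarrow>
    hinner H z (hadd H x y) = hinner H z x + hinner H z y"
  by (simp add: inner_commute[of z])

lemma inner_scale_right [simp]:
  "\<lbrakk>x \<in> hcarrier H; z \<in> hcarrier H\<rbrakk> \<Longrightarrow> hinner H z (hscale H c x) = c * hinner H z x"
  by (simp add: inner_commute[of z])

lemma minus_closed [simp]:
  "\<lbrakk>x \<in> hcarrier H; y \<in> hcarrier H\<rbrakk> \<Longrightarrow> hminus H x y \<in> hcarrier H"
  by (simp add: hminus_def)

lemma inner_minus_left [simp]:
  "\<lbrakk>x \<in> hcarrier H; y \<in> hcarrier H; z \<in> hcarrier H\<rbrakk> \<Longrightarrow>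
    hinner H (hminus H x y) z = hinner H x z - hinner H y z"
  by (simp add: hminus_def)

lemma inner_minus_right [simp]:
  "\<lbrakk>x \<in> hcarrier H; y \<in> hcarrier H; z \<in> hcarrier H\<rbrakk> \<Longrightarrow>
    hinner H z (hminus H x y) = hinner H z x - hinner H z y"
  by (simp add: hminus_def)

lemma hnorm_nonneg [simp]: "x \<in> hcarrier H \<Longrightarrow> 0 \<le> hnorm H x"
  by (simp add: hnorm_def)

lemma hnorm_power2: "x \<in> hcarrier H \<Longrightarrow> (hnorm H x)\<^sup>2 = hinner H x x"
  by (simp add: hnorm_def)

lemma hnorm_mult_self: "x \<in> hcarrier H \<Longrightarrow> hnorm H x * hnorm H x = hinner H x x"
  by (simp add: hnorm_def)

lemma cauchy_schwarz:
  assumes x: "x \<in> hcarrier H" and y: "y \<in> hcarrier H"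
  shows "\<bar>hinner H x y\<bar> \<le> hnorm H x * hnorm H y"
proof -
  have "(hinner H x y)\<^sup>2 \<le> hinner H x x * hinner H y y"
  proof (rule square_le_of_nonneg_quadratic)
    fix t
    let ?v = "hadd H x (hscale H t y)"
    have "0 \<le> hinner H ?v ?v"
      using x y by (intro inner_ge_zero) simp
    then show "0 \<le> hinner H x x + 2 * t * hinner H x y + t\<^sup>2 * hinner H y y"
      using x y inner_commute[of x y] by (simp add: algebra_simps power2_eq_square)
  qed (use y in simp)
  then have "sqrt ((hinner H x y)\<^sup>2) \<le> sqrt (hinner H x x * hinner H y y)"
    by (rule real_sqrt_le_mono)
  then show ?thesis
    by (simp add: hnorm_def real_sqrt_mult)
qed

lemma hnorm_add_le:
  assumes x: "x \<in> hcarrier H" and y: "y \<in> hcarrier H"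
  shows "hnorm H (hadd H x y) \<le> hnorm H x + hnorm H y"
proof (rule power2_le_imp_le)
  have "hinner H x y \<le> hnorm H x * hnorm H y"
    using cauchy_schwarz[OF x y] by simp
  then show "(hnorm H (hadd H x y))\<^sup>2 \<le> (hnorm H x + hnorm H y)\<^sup>2"
    using x y inner_commute[of x y]
    by (simp add: hnorm_power2 power2_sum)
qed (use x y in simp)

lemma inner_eq_0_of_hnorm_0:
  assumes "x \<in> hcarrier H" "y \<in> hcarrier H" "hnorm H x = 0"
  shows "hinner H x y = 0"
  using cauchy_schwarz[OF assms(1,2)] assms(3) by simp

lemma heq_iff_inner:
  assumes x: "x \<in> hcarrier H" and y: "y \<in> hcarrier H"
  shows "heq H x y \<longleftrightarrow> (\<forall>z\<in>hcarrier H. hinner H x z = hinner H y z)"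
proof
  assume "heq H x y"
  then show "\<forall>z\<in>hcarrier H. hinner H x z = hinner H y z"
    using inner_eq_0_of_hnorm_0[of "hminus H x y"] x y by (auto simp: heq_def)
next
  assume *: "\<forall>z\<in>hcarrier H. hinner H x z = hinner H y z"
  have "hinner H (hminus H x y) (hminus H x y) = 0"
    using * x y by simp
  then show "heq H x y"
    by (simp add: heq_def hnorm_def)
qed

lemma heq_inner_left:
  "\<lbrakk>heq H x y; x \<in> hcarrier H; y \<in> hcarrier H; z \<in> hcarrier H\<rbrakk> \<Longrightarrow> hinner H x z = hinner H y z"
  by (simp add: heq_iff_inner)

lemma heq_inner_right:
  "\<lbrakk>heq H x y; x \<in> hcarrier H; y \<in> hcarrier H; z \<in> hcarrier H\<rbrakk> \<Longrightarrow> hinner H z x = hinner H z y"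
  by (simp add: heq_iff_inner inner_commute[of z])

end

section \<open>Bounded operators\<close>

lemma bounded_op_closed: "\<lbrakk>bounded_op H K F; x \<in> hcarrier H\<rbrakk> \<Longrightarrow> F x \<in> hcarrier K"
  by (simp add: bounded_op_def)

locale semi_inner_pair = H: semi_inner_space H + K: semi_inner_space K
  for H :: "'h hspace" and K :: "'k hspace"
begin

lemma inner_op_add:
  assumes "bounded_op H K F" "x \<in> hcarrier H" "y \<in> hcarrier H" "z \<in> hcarrier K"
  shows "hinner K (F (hadd H x y)) z = hinner K (F x) z + hinner K (F y) z"
proof -
  have "heq K (F (hadd H x y)) (hadd K (F x) (F y))"
    using assms by (simp add: bounded_op_def)
  then have "hinner K (F (hadd H x y)) z = hinner K (hadd K (F x) (F y)) z"
    using assms by (intro K.heq_inner_left) (auto simp: bounded_op_closed[OF assms(1)])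
  then show ?thesis
    using assms by (simp add: bounded_op_closed[OF assms(1)])
qed

lemma inner_op_scale:
  assumes "bounded_op H K F" "x \<in> hcarrier H" "z \<in> hcarrier K"
  shows "hinner K (F (hscale H c x)) z = c * hinner K (F x) z"
proof -
  have "heq K (F (hscale H c x)) (hscale K c (F x))"
    using assms by (simp add: bounded_op_def)
  then have "hinner K (F (hscale H c x)) z = hinner K (hscale K c (F x)) z"
    using assms by (intro K.heq_inner_left) (auto simp: bounded_op_closed[OF assms(1)])
  then show ?thesis
    using assms by (simp add: bounded_op_closed[OF assms(1)])
qed

lemma inner_op_minus:
  assumes "bounded_op H K F" "x \<in> hcarrier H" "y \<in> hcarrier H" "z \<in> hcarrier K"
  shows "hinner K (F (hminus H x y)) z = hinner K (F x) z - hinner K (F y) z"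
  using assms by (simp add: hminus_def inner_op_add inner_op_scale)

lemma bounded_opE:
  assumes "bounded_op H K F"
  obtains M where "M > 0" "\<And>x. x \<in> hcarrier H \<Longrightarrow> hnorm K (F x) \<le> M * hnorm H x"
proof -
  from assms obtain M where M: "\<And>x. x \<in> hcarrier H \<Longrightarrow> hnorm K (F x) \<le> M * hnorm H x"
    unfolding bounded_op_def by blast
  have "hnorm K (F x) \<le> (\<bar>M\<bar> + 1) * hnorm H x" if "x \<in> hcarrier H" for x
    by (rule order_trans[OF M[OF that]]) (use that in \<open>auto intro!: mult_right_mono\<close>)
  then show thesis
    by (intro that[of "\<bar>M\<bar> + 1"]) auto
qed

lemma bounded_opI:
  assumes cl: "\<And>x. x \<in> hcarrier H \<Longrightarrow> F x \<in> hcarrier K"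
    and add: "\<And>x y z. \<lbrakk>x \<in> hcarrier H; y \<in> hcarrier H; z \<in> hcarrier K\<rbrakk> \<Longrightarrow>
      hinner K (F (hadd H x y)) z = hinner K (F x) z + hinner K (F y) z"
    and scale: "\<And>c x z. \<lbrakk>x \<in> hcarrier H; z \<in> hcarrier K\<rbrakk> \<Longrightarrow>
      hinner K (F (hscale H c x)) z = c * hinner K (F x) z"
    and bound: "\<And>x. x \<in> hcarrier H \<Longrightarrow> hnorm K (F x) \<le> M * hnorm H x"
  shows "bounded_op H K F"
  unfolding bounded_op_def
proof (intro conjI exI[of _ M])
qed (use assms in \<open>auto simp: K.heq_iff_inner\<close>)

lemma bounded_op_add:
  assumes F: "bounded_op H K F" and G: "bounded_op H K G"
  shows "bounded_op H K (F \<boxplus>\<^bsub>K\<^esub> G)"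
proof -
  from F obtain M where M: "\<And>x. x \<in> hcarrier H \<Longrightarrow> hnorm K (F x) \<le> M * hnorm H x"
    by (rule bounded_opE) blast
  from G obtain N where N: "\<And>x. x \<in> hcarrier H \<Longrightarrow> hnorm K (G x) \<le> N * hnorm H x"
    by (rule bounded_opE) blast
  have "hnorm K (hadd K (F x) (G x)) \<le> (M + N) * hnorm H x" if "x \<in> hcarrier H" for x
    using K.hnorm_add_le[of "F x" "G x"] M[OF that] N[OF that] that
    by (simp add: bounded_op_closed[OF F] bounded_op_closed[OF G] algebra_simps)
  then show ?thesis
    unfolding op_add_def
    by (intro bounded_opI[where M = "M + N"]) (simp_all add: bounded_op_closed[OF F] bounded_op_closed[OF G]
        inner_op_add[OF F] inner_op_add[OF G] inner_op_scale[OF F] inner_op_scale[OF G]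
        algebra_simps)
qed

end

lemma (in semi_inner_pair) inner_op_zero:
  assumes F: "bounded_op H K F" and z: "z \<in> hcarrier K"
  shows "hinner K (F (hzero H)) z = 0"
proof (rule K.inner_eq_0_of_hnorm_0[OF _ z])
  obtain M where "hnorm K (F (hzero H)) \<le> M * hnorm H (hzero H)"
    using F by (rule bounded_opE) (use H.zero_closed in blast)
  then show "hnorm K (F (hzero H)) = 0"
    using bounded_op_closed[OF F H.zero_closed] by (simp add: hnorm_def[of H] antisym)
qed (use bounded_op_closed[OF F] in simp)

text \<open>Operators are additive only up to \<open>heq\<close>. The additivity of \<open>F\<close> survives the application of \<open>G\<close>
  because a bounded operator sends null vectors to null vectors and therefore respects \<open>heq\<close>.\<close>

lemma bounded_op_comp:
  assumes "semi_inner_space J"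
    and pair: "semi_inner_pair H K" and F: "bounded_op J H F" and G: "bounded_op H K G"
  shows "bounded_op J K (G \<circ> F)"
proof -
  interpret J: semi_inner_space J by fact
  interpret HK: semi_inner_pair H K by fact
  interpret JH: semi_inner_pair J H ..
  interpret JK: semi_inner_pair J K ..
  obtain N where N: "N > 0" "\<And>x. x \<in> hcarrier H \<Longrightarrow> hnorm K (G x) \<le> N * hnorm H x"
    using G by (rule HK.bounded_opE) blast
  obtain M where M: "M > 0" "\<And>x. x \<in> hcarrier J \<Longrightarrow> hnorm H (F x) \<le> M * hnorm J x"
    using F by (rule JH.bounded_opE) blast
  note closed = bounded_op_closed[OF F] bounded_op_closed[OF G]
  have cong: "hinner K (G u) z = hinner K (G v) z"
    if "heq H u v" "u \<in> hcarrier H" "v \<in> hcarrier H" "z \<in> hcarrier K" for u v z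
  proof -
    have "hnorm K (G (hminus H u v)) \<le> N * hnorm H (hminus H u v)"
      using that by (intro N) simp
    then have "hnorm K (G (hminus H u v)) = 0"
      using that by (simp add: heq_def antisym closed)
    then have "hinner K (G (hminus H u v)) z = 0"
      using that by (intro HK.K.inner_eq_0_of_hnorm_0) (auto simp: closed)
    then show ?thesis
      using that HK.inner_op_minus[OF G] by simp
  qed
  show ?thesis
  proof (rule JK.bounded_opI)
    fix x y z assume xyz: "x \<in> hcarrier J" "y \<in> hcarrier J" "z \<in> hcarrier K"
    have "hinner K (G (F (hadd J x y))) z = hinner K (G (hadd H (F x) (F y))) z"
      using F xyz by (intro cong) (auto simp: bounded_op_def[of J H])
    then show "hinner K ((G \<circ> F) (hadd J x y)) z
        = hinner K ((G \<circ> F) x) z + hinner K ((G \<circ> F) y) z"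
      using G xyz by (simp add: HK.inner_op_add closed)
  next
    fix c x z assume xz: "x \<in> hcarrier J" "z \<in> hcarrier K"
    have "hinner K (G (F (hscale J c x))) z = hinner K (G (hscale H c (F x))) z"
      using F xz by (intro cong) (auto simp: bounded_op_def[of J H])
    then show "hinner K ((G \<circ> F) (hscale J c x)) z = c * hinner K ((G \<circ> F) x) z"
      using G xz by (simp add: HK.inner_op_scale closed)
  next
    fix x assume x: "x \<in> hcarrier J"
    have "hnorm K (G (F x)) \<le> N * hnorm H (F x)"
      using x by (intro N) (simp add: closed)
    also have "\<dots> \<le> N * (M * hnorm J x)"
      using N(1) M(2)[OF x] by (intro mult_left_mono) auto
    finally show "hnorm K ((G \<circ> F) x) \<le> (N * M) * hnorm J x"
      by (simp add: mult.assoc)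
  qed (simp add: closed)
qed

section \<open>Riesz representation, adjoints and inverses\<close>

text \<open>Completeness of the quotient by the null vectors, expressed on representatives.\<close>

locale hilbert_space = semi_inner_space +
  assumes complete: "\<lbrakk>\<And>k. X k \<in> hcarrier H;
      \<And>e. e > 0 \<Longrightarrow> \<exists>N. \<forall>k\<ge>N. \<forall>l\<ge>N. hnorm H (hminus H (X k) (X l)) < e\<rbrakk> \<Longrightarrow>
    \<exists>y\<in>hcarrier H. (\<lambda>k::nat. hnorm H (hminus H (X k) y)) \<longlonglongrightarrow> 0"
begin

text \<open>The representing vector is the minimiser of $J(x) = |x|^2 - 2\phi(x)$. The parallelogram law turns a
  minimising sequence into a Cauchy sequence, and the first variation of $J$ at its limit is the
  claim.\<close>

theorem riesz_representation:
  assumes add: "\<And>x y. \<lbrakk>x \<in> hcarrier H; y \<in> hcarrier H\<rbrakk> \<Longrightarrow> \<phi> (hadd H x y) = \<phi> x + \<phi> y"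
    and scale: "\<And>c x. x \<in> hcarrier H \<Longrightarrow> \<phi> (hscale H c x) = c * \<phi> x"
    and bound: "\<And>x. x \<in> hcarrier H \<Longrightarrow> \<bar>\<phi> x\<bar> \<le> K * hnorm H x"
  shows "\<exists>w\<in>hcarrier H. \<forall>x\<in>hcarrier H. hinner H x w = \<phi> x"
proof -
  define J where "J x = hinner H x x - 2 * \<phi> x" for x
  define d where "d = (INF x\<in>hcarrier H. J x)"
  have "- K\<^sup>2 \<le> J x" if x: "x \<in> hcarrier H" for x
  proof -
    have "\<phi> x \<le> K * hnorm H x"
      using bound[OF x] by simp
    moreover have "0 \<le> (hnorm H x - K)\<^sup>2"
      by simp
    ultimately show ?thesis
      using x by (simp add: J_def power2_diff hnorm_power2 algebra_simps)
  qed
  then have bdd: "bdd_below (J ` hcarrier H)"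
    by (auto simp: bdd_below_def)
  have d_le: "d \<le> J x" if "x \<in> hcarrier H" for x
    unfolding d_def using bdd that by (rule cINF_lower)
  have "\<exists>x\<in>hcarrier H. J x < d + 1 / real (Suc k)" for k
    using cINF_less_iff[OF _ bdd, of "d + 1 / real (Suc k)", folded d_def]
    by (metis empty_iff less_add_same_cancel1 of_nat_0_less_iff zero_closed zero_less_Suc
        zero_less_divide_1_iff)
  then obtain X where X: "\<And>k. X k \<in> hcarrier H" "\<And>k. J (X k) < d + 1 / real (Suc k)"
    by metis
  have Cauchy: "hinner H (hminus H x y) (hminus H x y) \<le> 2 * (J x - d) + 2 * (J y - d)"
    if x: "x \<in> hcarrier H" and y: "y \<in> hcarrier H" for x y
  proof -
    have "d \<le> J (hscale H (1 / 2) (hadd H x y))"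
      using x y by (intro d_le) simp
    then show ?thesis
      using x y inner_commute[of x y] by (simp add: J_def add scale field_simps)
  qed
  have X_Cauchy: "\<exists>N. \<forall>k\<ge>N. \<forall>l\<ge>N. hnorm H (hminus H (X k) (X l)) < e" if e: "e > 0" for e
  proof -
    obtain N where N: "1 / real (Suc N) < e\<^sup>2 / 4"
      using nat_approx_posE[of "e\<^sup>2 / 4"] e by auto
    have near: "J (X i) < d + e\<^sup>2 / 4" if "i \<ge> N" for i
    proof -
      have "1 / real (Suc i) \<le> 1 / real (Suc N)"
        using that by (simp add: field_simps)
      then have "d + 1 / real (Suc i) < d + e\<^sup>2 / 4"
        using N by (intro add_strict_left_mono) (rule order_le_less_trans)
      with X(2) show ?thesis
        by (rule order_less_trans)
    qed
    have "hnorm H (hminus H (X k) (X l)) < e" if "k \<ge> N" "l \<ge> N" for k l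
    proof -
      have "hinner H (hminus H (X k) (X l)) (hminus H (X k) (X l)) < e\<^sup>2"
      proof (rule order_le_less_trans[OF Cauchy])
        show "2 * (J (X k) - d) + 2 * (J (X l) - d) < e\<^sup>2"
          using near[OF that(1)] near[OF that(2)] by (simp add: field_simps)
      qed (use X in auto)
      then have "(hnorm H (hminus H (X k) (X l)))\<^sup>2 < e\<^sup>2"
        by (simp add: hnorm_power2 X)
      then show ?thesis
        by (rule power2_less_imp_less) (use e in simp)
    qed
    then show ?thesis by blast
  qed
  obtain w where w: "w \<in> hcarrier H" "(\<lambda>k. hnorm H (hminus H (X k) w)) \<longlonglongrightarrow> 0"
    using complete[OF X(1) X_Cauchy] by auto
  have "hinner H x w = \<phi> x" if x: "x \<in> hcarrier H" for x
  proof -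
    have lim: "(\<lambda>k. hinner H (X k) x - \<phi> x) \<longlonglongrightarrow> hinner H w x - \<phi> x"
    proof (rule tendsto_diff[OF _ tendsto_const])
      have "(\<lambda>k. hinner H (X k) x - hinner H w x) \<longlonglongrightarrow> 0"
      proof (rule tendsto_rabs_zero_cancel, rule tendsto_sandwich[where f = "\<lambda>_. 0"])
        show "\<forall>\<^sub>F k in sequentially. \<bar>hinner H (X k) x - hinner H w x\<bar>
            \<le> hnorm H (hminus H (X k) w) * hnorm H x"
          using cauchy_schwarz[of "hminus H (X _) w" x] X w x by (intro always_eventually) simp
        show "(\<lambda>k. hnorm H (hminus H (X k) w) * hnorm H x) \<longlonglongrightarrow> 0"
          using tendsto_mult_right[OF w(2), of "hnorm H x"] by simp
      qed auto
      then show "(\<lambda>k. hinner H (X k) x) \<longlonglongrightarrow> hinner H w x"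
        by (simp add: LIM_zero_iff)
    qed
    \<comment> \<open>The first variation in direction $x$: no $X_k + t x$ lies below the infimum.\<close>
    have "(hinner H w x - \<phi> x)\<^sup>2 \<le> 0 * hinner H x x"
    proof (rule square_le_of_nonneg_quadratic)
      fix t
      have approx: "0 \<le> 1 / real (Suc k) + 2 * t * (hinner H (X k) x - \<phi> x) + t\<^sup>2 * hinner H x x"
        for k
      proof -
        have "d \<le> J (hadd H (X k) (hscale H t x))"
          using X x by (intro d_le) simp
        also have "\<dots> = J (X k) + 2 * t * (hinner H (X k) x - \<phi> x) + t\<^sup>2 * hinner H x x"
          using X x inner_commute[of x "X k"]
          by (simp add: J_def add scale algebra_simps power2_eq_square)
        finally show ?thesis
          using X(2)[of k] by linarith
      qed
      have lim0: "(\<lambda>k. 1 / real (Suc k)) \<longlonglongrightarrow> 0"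
        using LIMSEQ_inverse_real_of_nat by (simp add: inverse_eq_divide)
      have "(\<lambda>k. 1 / real (Suc k) + 2 * t * (hinner H (X k) x - \<phi> x) + t\<^sup>2 * hinner H x x)
          \<longlonglongrightarrow> 0 + 2 * t * (hinner H w x - \<phi> x) + t\<^sup>2 * hinner H x x"
        by (intro tendsto_intros lim lim0)
      then show "0 \<le> 0 + 2 * t * (hinner H w x - \<phi> x) + t\<^sup>2 * hinner H x x"
        by (rule LIMSEQ_le_const) (use approx in auto)
    qed (use x in simp)
    then have "hinner H w x = \<phi> x"
      by simp
    then show ?thesis
      using x w by (simp add: inner_commute[of x])
  qed
  then show ?thesis
    using w(1) by blast
qed

end

text \<open>The adjoint is defined by a choice operator, so its defining property must be derived: Riesz
  representation of $x \mapsto \langle Fx, y\rangle$ supplies the value at $y$. Linearity and the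
  bound of \<open>F\<close> are then inherited through the duality.\<close>

lemma adj_exists:
  assumes "hilbert_space H" "semi_inner_space K" and F: "bounded_op H K F"
  shows "bounded_op K H (adj H K F) \<and>
    (\<forall>x\<in>hcarrier H. \<forall>y\<in>hcarrier K. hinner K (F x) y = hinner H x (adj H K F y))"
proof -
  interpret H: hilbert_space H by fact
  interpret K: semi_inner_space K by fact
  interpret HK: semi_inner_pair H K ..
  interpret KH: semi_inner_pair K H ..
  from F obtain M where M: "M > 0" "\<And>x. x \<in> hcarrier H \<Longrightarrow> hnorm K (F x) \<le> M * hnorm H x"
    by (rule HK.bounded_opE) blast
  note closed = bounded_op_closed[OF F]
  have "\<exists>w\<in>hcarrier H. \<forall>x\<in>hcarrier H. hinner H x w = hinner K (F x) y"
    if y: "y \<in> hcarrier K" for y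
  proof (rule H.riesz_representation)
    fix x assume x: "x \<in> hcarrier H"
    have "\<bar>hinner K (F x) y\<bar> \<le> hnorm K (F x) * hnorm K y"
      using x y by (intro K.cauchy_schwarz) (auto simp: closed)
    also have "\<dots> \<le> M * hnorm H x * hnorm K y"
      using M x y by (intro mult_right_mono) auto
    finally show "\<bar>hinner K (F x) y\<bar> \<le> M * hnorm K y * hnorm H x"
      by (simp add: mult_ac)
  qed (use F y in \<open>simp_all add: HK.inner_op_add HK.inner_op_scale\<close>)
  then obtain G where G: "\<And>y. y \<in> hcarrier K \<Longrightarrow> G y \<in> hcarrier H"
    and dual: "\<And>x y. \<lbrakk>x \<in> hcarrier H; y \<in> hcarrier K\<rbrakk> \<Longrightarrow> hinner H x (G y) = hinner K (F x) y"
    by metis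
  have dual': "hinner H (G y) x = hinner K y (F x)" if "x \<in> hcarrier H" "y \<in> hcarrier K" for x y
    using dual[OF that] that G H.inner_commute K.inner_commute by (metis closed)
  have "bounded_op K H G"
  proof (rule KH.bounded_opI)
    fix y assume y: "y \<in> hcarrier K"
    have "(hnorm H (G y))\<^sup>2 = hinner K (F (G y)) y"
      using y G by (simp add: H.hnorm_power2 dual)
    also have "\<dots> \<le> hnorm K (F (G y)) * hnorm K y"
      using K.cauchy_schwarz[of "F (G y)" y] G y by (simp add: closed)
    also have "\<dots> \<le> M * hnorm H (G y) * hnorm K y"
      using M G y by (intro mult_right_mono) auto
    finally have "hnorm H (G y) * hnorm H (G y) \<le> M * hnorm K y * hnorm H (G y)"
      by (simp add: power2_eq_square mult_ac)
    then show "hnorm H (G y) \<le> M * hnorm K y"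
      using H.hnorm_nonneg[OF G[OF y]] M(1) y
      by (cases "hnorm H (G y) = 0") (auto simp: mult_le_cancel_right)
  qed (use G in \<open>simp_all add: dual' closed\<close>)
  then have "\<exists>G. bounded_op K H G \<and>
     (\<forall>x\<in>hcarrier H. \<forall>y\<in>hcarrier K. hinner K (F x) y = hinner H x (G y))"
    using dual by metis
  then show ?thesis
    unfolding adj_def by (rule someI_ex)
qed

lemma selfadjoint_op_symmetric:
  assumes "hilbert_space H" "selfadjoint_op H F" "x \<in> hcarrier H" "y \<in> hcarrier H"
  shows "hinner H (F x) y = hinner H x (F y)"
proof -
  interpret H: hilbert_space H by fact
  have F: "bounded_op H H F"
    using assms by (simp add: selfadjoint_op_def)
  note adj = adj_exists[OF assms(1) H.semi_inner_space_axioms F]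
  have "heq H (F y) (adj H H F y)"
    using assms by (simp add: selfadjoint_op_def op_eq_def)
  then have "hinner H x (F y) = hinner H x (adj H H F y)"
    using assms adj bounded_op_closed[OF F] bounded_op_closed[of H H "adj H H F"]
    by (intro H.heq_inner_right) auto
  with adj assms show ?thesis by auto
qed

text \<open>A coercive self-adjoint operator defines the form $\langle x, Py\rangle$, which is equivalent to the
  original one, so the space is also complete for it. Riesz representation of
  $x \mapsto \langle x, y\rangle$ with respect to this new form is a solution $w$ of $Pw = y$.\<close>

lemma op_inv_exists:
  assumes "hilbert_space H" and P: "selfadjoint_op H P" and \<epsilon>: "\<epsilon> > 0"
    and coercive: "\<And>x. x \<in> hcarrier H \<Longrightarrow> \<epsilon> * hinner H x x \<le> hinner H x (P x)"
  shows "bounded_op H H (op_inv H P) \<and> op_eq H H (P \<circ> op_inv H P) id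
    \<and> op_eq H H (op_inv H P \<circ> P) id"
proof -
  interpret H: hilbert_space H by fact
  interpret HH: semi_inner_pair H H ..
  have P': "bounded_op H H P"
    using P by (simp add: selfadjoint_op_def)
  note Pcl = bounded_op_closed[OF P']
  note sym = selfadjoint_op_symmetric[OF \<open>hilbert_space H\<close> P]
  have Padd: "hinner H z (P (hadd H x y)) = hinner H z (P x) + hinner H z (P y)"
    if "x \<in> hcarrier H" "y \<in> hcarrier H" "z \<in> hcarrier H" for x y z
    using that HH.inner_op_add[OF P' that] Pcl H.inner_commute by (metis H.add_closed)
  have Pscale: "hinner H z (P (hscale H c x)) = c * hinner H z (P x)"
    if "x \<in> hcarrier H" "z \<in> hcarrier H" for x z c
    using that HH.inner_op_scale[OF P' that] Pcl H.inner_commute by (metis H.scale_closed)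
  obtain M where M: "M > 0" "\<And>x. x \<in> hcarrier H \<Longrightarrow> hnorm H (P x) \<le> M * hnorm H x"
    using P' by (rule HH.bounded_opE) blast
  \<comment> \<open>Only the form changes, so differences and the carrier of the two spaces coincide.\<close>
  define HP where "HP = H\<lparr>hinner := \<lambda>x y. hinner H x (P y)\<rparr>"
  have HP: "hcarrier HP = hcarrier H" "hzero HP = hzero H" "hadd HP = hadd H"
    "hscale HP = hscale H" "hminus HP = hminus H" "hinner HP x y = hinner H x (P y)" for x y
    by (auto simp: HP_def hminus_def fun_eq_iff)
  have nonneg: "0 \<le> hinner H x (P x)" if "x \<in> hcarrier H" for x
    using coercive[OF that] H.inner_ge_zero[OF that] \<epsilon>
    by (meson mult_nonneg_nonneg less_imp_le order_trans)
  have lower: "sqrt \<epsilon> * hnorm H x \<le> hnorm HP x" if "x \<in> hcarrier H" for x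
    unfolding hnorm_def HP using coercive[OF that]
    by (simp flip: real_sqrt_mult)
  have upper: "hnorm HP x \<le> sqrt M * hnorm H x" if x: "x \<in> hcarrier H" for x
  proof -
    have "hinner H x (P x) \<le> hnorm H x * hnorm H (P x)"
      using H.cauchy_schwarz[of x "P x"] x Pcl by simp
    also have "\<dots> \<le> hnorm H x * (M * hnorm H x)"
      using M x by (intro mult_left_mono) auto
    also have "\<dots> = M * hinner H x x"
      using H.hnorm_mult_self[OF x] by simp
    finally show ?thesis
      unfolding hnorm_def HP by (simp flip: real_sqrt_mult)
  qed
  interpret HP: hilbert_space HP
  proof unfold_locales
    fix X :: "nat \<Rightarrow> 'a"
    assume X: "\<And>k. X k \<in> hcarrier HP"
      and Cauchy: "\<And>e. e > 0 \<Longrightarrow> \<exists>N. \<forall>k\<ge>N. \<forall>l\<ge>N. hnorm HP (hminus HP (X k) (X l)) < e"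
    have "\<exists>N. \<forall>k\<ge>N. \<forall>l\<ge>N. hnorm H (hminus H (X k) (X l)) < e" if e: "e > 0" for e
    proof -
      obtain N where N: "\<And>k l. \<lbrakk>k \<ge> N; l \<ge> N\<rbrakk> \<Longrightarrow> hnorm HP (hminus H (X k) (X l)) < sqrt \<epsilon> * e"
        using Cauchy[of "sqrt \<epsilon> * e"] e \<epsilon> by (auto simp: HP)
      have "hnorm H (hminus H (X k) (X l)) < e" if "k \<ge> N" "l \<ge> N" for k l
      proof -
        have "sqrt \<epsilon> * hnorm H (hminus H (X k) (X l)) < sqrt \<epsilon> * e"
          using lower[of "hminus H (X k) (X l)"] N[OF that] X by (simp add: HP)
        then show ?thesis
          using \<epsilon> by simp
      qed
      then show ?thesis by blast
    qed
    moreover have X': "\<And>k. X k \<in> hcarrier H"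
      using X by (simp add: HP)
    ultimately obtain y where y: "y \<in> hcarrier H"
      "(\<lambda>k. hnorm H (hminus H (X k) y)) \<longlonglongrightarrow> 0"
      using H.complete[of X] by auto
    have "(\<lambda>k. hnorm HP (hminus H (X k) y)) \<longlonglongrightarrow> 0"
    proof (rule tendsto_sandwich[where f = "\<lambda>_. 0"])
      show "(\<lambda>k. sqrt M * hnorm H (hminus H (X k) y)) \<longlonglongrightarrow> 0"
        using tendsto_mult_left[OF y(2), of "sqrt M"] by simp
      show "\<forall>\<^sub>F k in sequentially. 0 \<le> hnorm HP (hminus H (X k) y)"
        using X y nonneg by (intro always_eventually) (auto simp: hnorm_def HP)
      show "\<forall>\<^sub>F k in sequentially. hnorm HP (hminus H (X k) y)
          \<le> sqrt M * hnorm H (hminus H (X k) y)"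
        using X y by (intro always_eventually allI upper) (simp add: HP)
    qed auto
    then show "\<exists>y\<in>hcarrier HP. (\<lambda>k. hnorm HP (hminus HP (X k) y)) \<longlonglongrightarrow> 0"
      using y(1) by (auto simp: HP)
  next
    fix x y assume "x \<in> hcarrier HP" "y \<in> hcarrier HP"
    then show "hinner HP x y = hinner HP y x"
      using sym[of x y] Pcl[of x] H.inner_commute[of y "P x"] by (simp add: HP)
  qed (simp_all add: HP Pcl nonneg)
  have "\<exists>w\<in>hcarrier HP. \<forall>x\<in>hcarrier HP. hinner HP x w = hinner H x y"
    if y: "y \<in> hcarrier H" for y
  proof (rule HP.riesz_representation)
    fix x assume x: "x \<in> hcarrier HP"
    have "\<bar>hinner H x y\<bar> \<le> hnorm H x * hnorm H y"
      using x y by (intro H.cauchy_schwarz) (auto simp: HP)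
    also have "hnorm H x \<le> hnorm HP x / sqrt \<epsilon>"
      using lower[of x] x \<epsilon> by (simp add: HP field_simps)
    finally show "\<bar>hinner H x y\<bar> \<le> (hnorm H y / sqrt \<epsilon>) * hnorm HP x"
      using y by (simp add: mult_right_mono mult_ac)
  qed (use y in \<open>simp_all add: HP\<close>)
  then obtain G where G: "\<And>y. y \<in> hcarrier H \<Longrightarrow> G y \<in> hcarrier H"
    and inv: "\<And>x y. \<lbrakk>x \<in> hcarrier H; y \<in> hcarrier H\<rbrakk> \<Longrightarrow> hinner H x (P (G y)) = hinner H x y"
    unfolding HP by metis
  have zero_of_orth: "hnorm H u = 0"
    if "u \<in> hcarrier H" "\<And>x. x \<in> hcarrier H \<Longrightarrow> hinner H x (P u) = 0" for u
  proof -
    have "\<epsilon> * hinner H u u \<le> 0"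
      using coercive[OF that(1)] that by simp
    then have "hinner H u u = 0"
      using \<epsilon> H.inner_ge_zero[OF that(1)] by (simp add: mult_le_0_iff)
    then show ?thesis by (simp add: hnorm_def)
  qed
  have Pminus: "hinner H z (P (hminus H x y)) = hinner H z (P x) - hinner H z (P y)"
    if "x \<in> hcarrier H" "y \<in> hcarrier H" "z \<in> hcarrier H" for x y z
    using that by (simp add: hminus_def Padd Pscale)
  have Gbound: "hnorm H (G y) \<le> (1 / \<epsilon>) * hnorm H y" if y: "y \<in> hcarrier H" for y
  proof -
    have "\<epsilon> * (hnorm H (G y))\<^sup>2 \<le> hinner H (G y) y"
      using coercive[OF G[OF y]] G y by (simp add: inv H.hnorm_power2)
    also have "\<dots> \<le> hnorm H (G y) * hnorm H y"
      using H.cauchy_schwarz[of "G y" y] G y by simp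
    finally have "\<epsilon> * hnorm H (G y) * hnorm H (G y) \<le> hnorm H y * hnorm H (G y)"
      by (simp add: power2_eq_square mult_ac)
    then have "\<epsilon> * hnorm H (G y) \<le> hnorm H y"
      using H.hnorm_nonneg[OF G[OF y]] y
      by (cases "hnorm H (G y) = 0") (auto simp: mult_le_cancel_right)
    then show ?thesis
      using \<epsilon> by (simp add: field_simps)
  qed
  have "bounded_op H H G"
    unfolding bounded_op_def
  proof (intro conjI ballI allI exI[of _ "1 / \<epsilon>"])
    fix x y assume xy: "x \<in> hcarrier H" "y \<in> hcarrier H"
    show "heq H (G (hadd H x y)) (hadd H (G x) (G y))"
      unfolding heq_def using xy G by (intro zero_of_orth) (simp_all add: Pminus Padd inv)
  next
    fix c x assume x: "x \<in> hcarrier H"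
    show "heq H (G (hscale H c x)) (hscale H c (G x))"
      unfolding heq_def using x G by (intro zero_of_orth) (simp_all add: Pminus Pscale inv)
  qed (use G Gbound in auto)
  moreover have "op_eq H H (P \<circ> G) id"
    unfolding op_eq_def
  proof
    fix y assume y: "y \<in> hcarrier H"
    have "hinner H (P (G y)) x = hinner H y x" if "x \<in> hcarrier H" for x
      using inv[OF that y] H.inner_commute[of x] G[OF y] Pcl y that by simp
    then show "heq H ((P \<circ> G) y) (id y)"
      using G y Pcl by (simp add: H.heq_iff_inner)
  qed
  moreover have "op_eq H H (G \<circ> P) id"
    unfolding op_eq_def heq_def comp_def id_def
    using G Pcl by (intro ballI zero_of_orth) (simp_all add: Pminus inv)
  ultimately have "\<exists>G. bounded_op H H G \<and> op_eq H H (P \<circ> G) id \<and> op_eq H H (G \<circ> P) id"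
    by blast
  then show ?thesis
    unfolding op_inv_def by (rule someI_ex)
qed

section \<open>Completeness of $R^k$ and $RL_2^{m,n}[a,b]$\<close>

text \<open>A subsequence with rapidly shrinking increments converges almost everywhere, because its increments
  have a finite sum in $L_1$ of the finite measure space. Fatou's lemma then transfers the Cauchy
  estimates to the limit.\<close>

lemma L2_sequence_limit_real:
  fixes f :: "nat \<Rightarrow> 'a \<Rightarrow> real"
  assumes fin: "finite_measure M"
    and meas [measurable]: "\<And>k. f k \<in> borel_measurable M"
    and sq: "\<And>k. integrable M (\<lambda>s. (f k s)\<^sup>2)"
    and Cauchy: "\<And>e. e > 0 \<Longrightarrow> \<exists>N. \<forall>k\<ge>N. \<forall>l\<ge>N. (\<integral>s. (f k s - f l s)\<^sup>2 \<partial>M) < e"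
  shows "\<exists>g\<in>borel_measurable M. integrable M (\<lambda>s. (g s)\<^sup>2) \<and>
    (\<lambda>k. \<integral>s. (f k s - g s)\<^sup>2 \<partial>M) \<longlonglongrightarrow> 0"
proof -
  interpret finite_measure M by fact
  have sqdiff: "integrable M (\<lambda>s. (u s - v s)\<^sup>2)"
    if [measurable]: "u \<in> borel_measurable M" "v \<in> borel_measurable M"
      and "integrable M (\<lambda>s. (u s)\<^sup>2)" "integrable M (\<lambda>s. (v s)\<^sup>2)" for u v :: "'a \<Rightarrow> real"
  proof (rule Bochner_Integration.integrable_bound)
    show "integrable M (\<lambda>s. 2 * (u s)\<^sup>2 + 2 * (v s)\<^sup>2)"
      using that by auto
    have "(x - y)\<^sup>2 \<le> 2 * x\<^sup>2 + 2 * y\<^sup>2" for x y :: real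
      using sum_squares_bound[of x "- y"] by (simp add: power2_diff)
    then show "AE s in M. norm ((u s - v s)\<^sup>2) \<le> norm (2 * (u s)\<^sup>2 + 2 * (v s)\<^sup>2)"
      by auto
  qed measurable
  have "\<forall>j. \<exists>N. \<forall>k\<ge>N. \<forall>l\<ge>N. (\<integral>s. (f k s - f l s)\<^sup>2 \<partial>M) < (1 / 4) ^ j"
    using Cauchy by simp
  then obtain N where N: "\<And>j k l. \<lbrakk>k \<ge> N j; l \<ge> N j\<rbrakk> \<Longrightarrow> (\<integral>s. (f k s - f l s)\<^sup>2 \<partial>M) < (1 / 4) ^ j"
    by metis
  \<comment> \<open>The sum makes $r(j)$ at least $N(0), \ldots, N(j)$, and the summand $j$ makes $r$ unbounded.\<close>
  define r where "r j = j + (\<Sum>i\<le>j. N i)" for j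
  have N_le: "N j \<le> (\<Sum>i\<le>j. N i)" for j
    by (rule member_le_sum) auto
  have r_ge: "r j \<ge> N j" "r j \<ge> j" "r (Suc j) \<ge> N j" for j
    using N_le[of j] by (auto simp: r_def)
  define d where "d j s = f (r (Suc j)) s - f (r j) s" for j s
  have d_meas [measurable]: "d j \<in> borel_measurable M" for j
    unfolding d_def by measurable
  have dsq: "integrable M (\<lambda>s. (d j s)\<^sup>2)" for j
    unfolding d_def by (intro sqdiff sq meas)
  \<comment> \<open>This bounds the $L_1$-norm of an increment by its squared $L_2$-norm: $4^{-j}$ there gives $2^{-j}$ here.\<close>
  have AMGM: "\<bar>x\<bar> \<le> 2 ^ j * x\<^sup>2 + (1 / 2) ^ j" for x :: real and j :: nat
  proof -
    have "0 \<le> (2 ^ j * \<bar>x\<bar> - 1)\<^sup>2 / 2 ^ j"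
      by simp
    also have "\<dots> = 2 ^ j * x\<^sup>2 + (1 / 2) ^ j - 2 * \<bar>x\<bar>"
      by (simp add: power2_diff field_simps power2_eq_square power_divide)
    finally show ?thesis by linarith
  qed
  have dint: "integrable M (\<lambda>s. \<bar>d j s\<bar>)"
    and dbound: "(\<integral>s. \<bar>d j s\<bar> \<partial>M) \<le> (1 + measure M (space M)) * (1 / 2) ^ j" for j
  proof -
    have int: "integrable M (\<lambda>s. 2 ^ j * (d j s)\<^sup>2 + (1 / 2) ^ j)"
      using dsq by simp
    show abs: "integrable M (\<lambda>s. \<bar>d j s\<bar>)"
      by (rule Bochner_Integration.integrable_bound[OF int]) (use AMGM in auto)
    have "(\<integral>s. \<bar>d j s\<bar> \<partial>M) \<le> (\<integral>s. 2 ^ j * (d j s)\<^sup>2 + (1 / 2) ^ j \<partial>M)"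
      by (rule integral_mono[OF abs int AMGM])
    also have "\<dots> = 2 ^ j * (\<integral>s. (d j s)\<^sup>2 \<partial>M) + measure M (space M) * (1 / 2) ^ j"
      using dsq by simp
    also have "\<dots> \<le> 2 ^ j * (1 / 4) ^ j + measure M (space M) * (1 / 2) ^ j"
      using N[OF r_ge(3) r_ge(1), of j] unfolding d_def by (intro add_right_mono mult_left_mono) auto
    also have "(2::real) ^ j * (1 / 4) ^ j = (1 / 2) ^ j"
      by (simp flip: power_mult_distrib)
    finally show "(\<integral>s. \<bar>d j s\<bar> \<partial>M) \<le> (1 + measure M (space M)) * (1 / 2) ^ j"
      by (simp add: algebra_simps)
  qed
  have "AE s in M. summable (\<lambda>j. \<bar>d j s\<bar>)"
  proof -
    have sum: "summable (\<lambda>j. \<integral>s. \<bar>d j s\<bar> \<partial>M)"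
    proof (rule summable_comparison_test')
      show "summable (\<lambda>j. (1 + measure M (space M)) * (1 / 2 :: real) ^ j)"
        by (intro summable_mult summable_geometric) simp
      show "norm (\<integral>s. \<bar>d j s\<bar> \<partial>M) \<le> (1 + measure M (space M)) * (1 / 2) ^ j" if "j \<ge> 0" for j
        using dbound by simp
    qed
    have "(\<integral>\<^sup>+s. (\<Sum>j. ennreal \<bar>d j s\<bar>) \<partial>M) = (\<Sum>j. \<integral>\<^sup>+s. ennreal \<bar>d j s\<bar> \<partial>M)"
      by (rule nn_integral_suminf) measurable
    also have "\<dots> = (\<Sum>j. ennreal (\<integral>s. \<bar>d j s\<bar> \<partial>M))"
      by (intro suminf_cong nn_integral_eq_integral dint) simp
    also have "\<dots> \<noteq> \<infinity>"
      using sum by (subst suminf_ennreal2) auto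
    finally have "AE s in M. (\<Sum>j. ennreal \<bar>d j s\<bar>) \<noteq> \<infinity>"
      by (intro nn_integral_PInf_AE) measurable
    then show ?thesis
      by eventually_elim (simp add: summable_suminf_not_top)
  qed
  then have conv: "AE s in M. convergent (\<lambda>j. f (r j) s)"
  proof eventually_elim
    case (elim s)
    then have "summable (\<lambda>j. d j s)"
      by (rule summable_rabs_cancel)
    then have "convergent (\<lambda>n. \<Sum>j<n. d j s)"
      by (simp add: summable_iff_convergent)
    then have "convergent (\<lambda>n. (\<Sum>j<n. d j s) + f (r 0) s)"
      by (intro convergent_add convergent_const)
    also have "(\<lambda>n. (\<Sum>j<n. d j s) + f (r 0) s) = (\<lambda>n. f (r n) s)"
      unfolding d_def by (subst sum_lessThan_telescope) simp
    finally show ?case .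
  qed
  define g where "g s = lim (\<lambda>j. f (r j) s)" for s
  have g_meas [measurable]: "g \<in> borel_measurable M"
    unfolding g_def by measurable
  \<comment> \<open>Fatou along the subsequence: a bound on the distances to all late members holds for the limit.\<close>
  have close: "(\<integral>\<^sup>+s. ennreal ((f k s - g s)\<^sup>2) \<partial>M) \<le> ennreal e"
    if k: "\<And>l. l \<ge> n \<Longrightarrow> (\<integral>s. (f k s - f l s)\<^sup>2 \<partial>M) \<le> e" for k n e
  proof -
    have "(\<integral>\<^sup>+s. ennreal ((f k s - g s)\<^sup>2) \<partial>M)
        = (\<integral>\<^sup>+s. liminf (\<lambda>j. ennreal ((f k s - f (r j) s)\<^sup>2)) \<partial>M)"
    proof (rule nn_integral_cong_AE, use conv in eventually_elim)
      fix s assume "convergent (\<lambda>j. f (r j) s)"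
      then have "(\<lambda>j. f (r j) s) \<longlonglongrightarrow> g s"
        by (simp add: g_def convergent_LIMSEQ_iff)
      then have "(\<lambda>j. ennreal ((f k s - f (r j) s)\<^sup>2)) \<longlonglongrightarrow> ennreal ((f k s - g s)\<^sup>2)"
        by (intro tendsto_ennrealI tendsto_intros)
      then show "ennreal ((f k s - g s)\<^sup>2) = liminf (\<lambda>j. ennreal ((f k s - f (r j) s)\<^sup>2))"
        by (intro lim_imp_Liminf[symmetric]) auto
    qed
    also have "\<dots> \<le> liminf (\<lambda>j. \<integral>\<^sup>+s. ennreal ((f k s - f (r j) s)\<^sup>2) \<partial>M)"
      by (rule nn_integral_liminf) measurable
    also have "\<dots> \<le> liminf (\<lambda>j. ennreal e)"
    proof (rule Liminf_mono)
      have "(\<integral>\<^sup>+s. ennreal ((f k s - f (r j) s)\<^sup>2) \<partial>M) \<le> ennreal e" if "j \<ge> n" for j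
        using k[of "r j"] r_ge(2)[of j] that
        by (subst nn_integral_eq_integral) (auto intro!: sqdiff sq meas ennreal_leI)
      then show "\<forall>\<^sub>F j in sequentially. (\<integral>\<^sup>+s. ennreal ((f k s - f (r j) s)\<^sup>2) \<partial>M) \<le> ennreal e"
        by (auto simp: eventually_sequentially)
    qed
    also have "\<dots> = ennreal e"
      by (simp add: Liminf_const)
    finally show ?thesis .
  qed
  have diff_int: "integrable M (\<lambda>s. (f (r 0) s - g s)\<^sup>2)"
  proof (rule integrableI_bounded)
    have "(\<integral>\<^sup>+s. ennreal ((f (r 0) s - g s)\<^sup>2) \<partial>M) \<le> ennreal 1"
      using N[of 0 "r 0"] r_ge(1)[of 0] by (intro close[of "N 0"]) (auto intro: less_imp_le)
    then show "(\<integral>\<^sup>+s. ennreal (norm ((f (r 0) s - g s)\<^sup>2)) \<partial>M) < \<infinity>"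
      by (auto simp: order_le_less_trans)
  qed measurable
  have gsq: "integrable M (\<lambda>s. (g s)\<^sup>2)"
  proof -
    \<comment> \<open>$g$ is the difference of the square integrable functions $f_{r(0)}$ and $f_{r(0)} - g$.\<close>
    have "integrable M (\<lambda>s. (f (r 0) s - (f (r 0) s - g s))\<^sup>2)"
      by (intro sqdiff sq meas diff_int) measurable
    then show ?thesis by simp
  qed
  have "(\<lambda>k. \<integral>s. (f k s - g s)\<^sup>2 \<partial>M) \<longlonglongrightarrow> 0"
  proof (rule LIMSEQ_I)
    fix e :: real assume e: "e > 0"
    obtain n where n: "\<And>k l. \<lbrakk>k \<ge> n; l \<ge> n\<rbrakk> \<Longrightarrow> (\<integral>s. (f k s - f l s)\<^sup>2 \<partial>M) < e / 2"
      using Cauchy[of "e / 2"] e by auto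
    have "(\<integral>s. (f k s - g s)\<^sup>2 \<partial>M) < e" if "k \<ge> n" for k
    proof -
      have "ennreal (\<integral>s. (f k s - g s)\<^sup>2 \<partial>M) = (\<integral>\<^sup>+s. ennreal ((f k s - g s)\<^sup>2) \<partial>M)"
        by (intro nn_integral_eq_integral[symmetric] sqdiff meas sq g_meas gsq) simp
      also have "\<dots> \<le> ennreal (e / 2)"
        using n that by (intro close[of n]) (auto intro: less_imp_le)
      finally show ?thesis
        using e by simp
    qed
    then show "\<exists>no. \<forall>n\<ge>no. norm ((\<integral>s. (f n s - g s)\<^sup>2 \<partial>M) - 0) < e"
      by auto
  qed
  with gsq show ?thesis
    using g_meas by blast
qed

lemma L2_product_integrable:
  assumes f: "f \<in> L2 a b n" and g: "g \<in> L2 a b n" and i: "i < n"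
  shows "integrable (lebesgue_on {a..b}) (\<lambda>s. vec_index (f s) i * vec_index (g s) i)"
proof (rule Bochner_Integration.integrable_bound)
  show "integrable (lebesgue_on {a..b}) (\<lambda>s. (vec_index (f s) i)\<^sup>2 + (vec_index (g s) i)\<^sup>2)"
    using f g i by (auto simp: L2_def)
  show "(\<lambda>s. vec_index (f s) i * vec_index (g s) i) \<in> borel_measurable (lebesgue_on {a..b})"
    using f g i by (intro borel_measurable_times) (auto simp: L2_def)
  have "\<bar>x * y\<bar> \<le> x\<^sup>2 + y\<^sup>2" for x y :: real
  proof -
    have "2 * (\<bar>x\<bar> * \<bar>y\<bar>) \<le> x\<^sup>2 + y\<^sup>2"
      using sum_squares_bound[of "\<bar>x\<bar>" "\<bar>y\<bar>"] by simp
    moreover have "0 \<le> \<bar>x\<bar> * \<bar>y\<bar>"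
      by simp
    ultimately show ?thesis
      unfolding abs_mult by linarith
  qed
  then show "AE s in lebesgue_on {a..b}. norm (vec_index (f s) i * vec_index (g s) i)
      \<le> norm ((vec_index (f s) i)\<^sup>2 + (vec_index (g s) i)\<^sup>2)"
    by simp
qed

lemma scalar_prod_eq_sum:
  "v \<in> carrier_vec n \<Longrightarrow> scalar_prod u v = (\<Sum>i<n. vec_index u i * vec_index v i)"
  by (auto simp: scalar_prod_def atLeast0LessThan)

lemma
  assumes f: "f \<in> L2 a b n" and g: "g \<in> L2 a b n"
  shows L2_scalar_prod_integrable:
      "integrable (lebesgue_on {a..b}) (\<lambda>s. scalar_prod (f s) (g s))"
    and L2_scalar_prod_integral:
      "(\<integral>s. scalar_prod (f s) (g s) \<partial>lebesgue_on {a..b})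
        = (\<Sum>i<n. \<integral>s. vec_index (f s) i * vec_index (g s) i \<partial>lebesgue_on {a..b})"
proof -
  let ?M = "lebesgue_on {a..b}"
  have eq: "scalar_prod (f s) (g s) = (\<Sum>i<n. vec_index (f s) i * vec_index (g s) i)"
    if "s \<in> space ?M" for s
    using g that by (intro scalar_prod_eq_sum) (auto simp: L2_def)
  have int: "integrable ?M (\<lambda>s. vec_index (f s) i * vec_index (g s) i)" if "i < n" for i
    by (rule L2_product_integrable[OF f g that])
  have "integrable ?M (\<lambda>s. \<Sum>i<n. vec_index (f s) i * vec_index (g s) i)"
    using int by auto
  then show "integrable ?M (\<lambda>s. scalar_prod (f s) (g s))"
    by (rule Bochner_Integration.integrable_cong[THEN iffD2, rotated -1]) (auto simp: eq)
  have "(\<integral>s. scalar_prod (f s) (g s) \<partial>?M)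
      = (\<integral>s. (\<Sum>i<n. vec_index (f s) i * vec_index (g s) i) \<partial>?M)"
    by (rule Bochner_Integration.integral_cong) (auto simp: eq)
  also have "\<dots> = (\<Sum>i<n. \<integral>s. vec_index (f s) i * vec_index (g s) i \<partial>?M)"
    using int by (intro Bochner_Integration.integral_sum) auto
  finally show "(\<integral>s. scalar_prod (f s) (g s) \<partial>?M)
      = (\<Sum>i<n. \<integral>s. vec_index (f s) i * vec_index (g s) i \<partial>?M)" .
qed

lemma L2_carrier: "\<lbrakk>f \<in> L2 a b n; s \<in> {a..b}\<rbrakk> \<Longrightarrow> f s \<in> carrier_vec n"
  by (simp add: L2_def)

lemma L2I:
  assumes "\<And>s. s \<in> {a..b} \<Longrightarrow> f s \<in> carrier_vec n"
    and "\<And>i s. \<lbrakk>i < n; s \<in> {a..b}\<rbrakk> \<Longrightarrow> vec_index (f s) i = c i s"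
    and "\<And>i. i < n \<Longrightarrow> c i \<in> borel_measurable (lebesgue_on {a..b})"
    and "\<And>i. i < n \<Longrightarrow> integrable (lebesgue_on {a..b}) (\<lambda>s. (c i s)\<^sup>2)"
  shows "f \<in> L2 a b n"
proof -
  have "(\<lambda>s. vec_index (f s) i) \<in> borel_measurable (lebesgue_on {a..b})" if "i < n" for i
    using assms(3)[OF that] by (rule measurable_cong[THEN iffD2, rotated]) (use assms(2) that in auto)
  moreover have "integrable (lebesgue_on {a..b}) (\<lambda>s. (vec_index (f s) i)\<^sup>2)" if "i < n" for i
    using assms(4)[OF that]
    by (rule Bochner_Integration.integrable_cong[THEN iffD2, rotated -1]) (use assms(2) that in auto)
  ultimately show ?thesis
    using assms(1) by (auto simp: L2_def)
qed

lemma L2_add: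
  assumes f: "f \<in> L2 a b n" and g: "g \<in> L2 a b n"
  shows "(\<lambda>s. f s + g s) \<in> L2 a b n"
proof (rule L2I)
  fix i assume i: "i < n"
  show "(\<lambda>s. vec_index (f s) i + vec_index (g s) i) \<in> borel_measurable (lebesgue_on {a..b})"
    using f g i by (intro borel_measurable_add) (auto simp: L2_def)
  have "integrable (lebesgue_on {a..b}) (\<lambda>s. (vec_index (f s) i)\<^sup>2 + (vec_index (g s) i)\<^sup>2
      + 2 * (vec_index (f s) i * vec_index (g s) i))"
    using f g i L2_product_integrable[OF f g i]
    by (intro Bochner_Integration.integrable_add integrable_mult_right) (auto simp: L2_def)
  then show "integrable (lebesgue_on {a..b}) (\<lambda>s. (vec_index (f s) i + vec_index (g s) i)\<^sup>2)"
    by (simp add: power2_sum mult.assoc)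
next
  fix i s assume "i < n" "s \<in> {a..b}"
  then show "vec_index (f s + g s) i = vec_index (f s) i + vec_index (g s) i"
    using L2_carrier[OF g, of s] by auto
next
  fix s assume "s \<in> {a..b}"
  then show "f s + g s \<in> carrier_vec n"
    using L2_carrier[OF g, of s] L2_carrier[OF f, of s] by auto
qed

lemma L2_scale:
  assumes f: "f \<in> L2 a b n"
  shows "(\<lambda>s. c \<cdot>\<^sub>v f s) \<in> L2 a b n"
proof (rule L2I)
  fix i assume i: "i < n"
  show "(\<lambda>s. c * vec_index (f s) i) \<in> borel_measurable (lebesgue_on {a..b})"
    using f i by (intro borel_measurable_times) (auto simp: L2_def)
  show "integrable (lebesgue_on {a..b}) (\<lambda>s. (c * vec_index (f s) i)\<^sup>2)"
    using f i by (auto simp: L2_def power_mult_distrib)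
next
  fix i s assume "i < n" "s \<in> {a..b}"
  then show "vec_index (c \<cdot>\<^sub>v f s) i = c * vec_index (f s) i"
    using L2_carrier[OF f, of s] by auto
qed (use L2_carrier[OF f] in auto)

lemma L2_zero: "(\<lambda>s. 0\<^sub>v n) \<in> L2 a b n"
  by (rule L2I[where c = "\<lambda>i s. 0"]) auto

lemma scalar_prod_self_nonneg: "0 \<le> scalar_prod (v :: rvec) v"
  by (auto simp: scalar_prod_def intro!: sum_nonneg)

lemma semi_inner_space_Rn: "semi_inner_space (Rn k)"
  by unfold_locales
    (auto simp: Rn_def scalar_prod_self_nonneg intro: comm_scalar_prod add_scalar_prod_distrib)

lemma hinner_RL2:
  assumes "x \<in> hcarrier (RL2 a b m n)" "y \<in> hcarrier (RL2 a b m n)"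
  shows "hinner (RL2 a b m n) x y = (\<Sum>i<m. vec_index (fst x) i * vec_index (fst y) i)
    + (\<Sum>i<n. \<integral>s. vec_index (snd x s) i * vec_index (snd y s) i \<partial>lebesgue_on {a..b})"
  using assms by (auto simp: RL2_def L2_scalar_prod_integral scalar_prod_eq_sum[of _ m])

lemma semi_inner_space_RL2: "semi_inner_space (RL2 a b m n)"
proof
  fix x y assume "x \<in> hcarrier (RL2 a b m n)" "y \<in> hcarrier (RL2 a b m n)"
  then show "hinner (RL2 a b m n) x y = hinner (RL2 a b m n) y x"
    by (simp add: hinner_RL2 mult.commute)
next
  fix x y z
  assume x: "x \<in> hcarrier (RL2 a b m n)" and y: "y \<in> hcarrier (RL2 a b m n)"
    and z: "z \<in> hcarrier (RL2 a b m n)"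
  have "(\<integral>s. scalar_prod (snd x s + snd y s) (snd z s) \<partial>lebesgue_on {a..b})
      = (\<integral>s. scalar_prod (snd x s) (snd z s) + scalar_prod (snd y s) (snd z s)
          \<partial>lebesgue_on {a..b})"
    using x y z
    by (intro Bochner_Integration.integral_cong)
      (auto simp: RL2_def intro!: add_scalar_prod_distrib[of _ n] intro: L2_carrier)
  then show "hinner (RL2 a b m n) (hadd (RL2 a b m n) x y) z
      = hinner (RL2 a b m n) x z + hinner (RL2 a b m n) y z"
    using x y z by (auto simp: RL2_def add_scalar_prod_distrib[of _ m] L2_scalar_prod_integrable)
next
  fix x z c
  assume x: "x \<in> hcarrier (RL2 a b m n)" and z: "z \<in> hcarrier (RL2 a b m n)"
  have "(\<integral>s. scalar_prod (c \<cdot>\<^sub>v snd x s) (snd z s) \<partial>lebesgue_on {a..b})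
      = (\<integral>s. c * scalar_prod (snd x s) (snd z s) \<partial>lebesgue_on {a..b})"
    using x z
    by (intro Bochner_Integration.integral_cong)
      (auto simp: RL2_def intro!: smult_scalar_prod_distrib[of _ n] intro: L2_carrier)
  then show "hinner (RL2 a b m n) (hscale (RL2 a b m n) c x) z = c * hinner (RL2 a b m n) x z"
    using x z by (auto simp: RL2_def smult_scalar_prod_distrib[of _ m] algebra_simps)
next
  fix x assume x: "x \<in> hcarrier (RL2 a b m n)"
  then show "0 \<le> hinner (RL2 a b m n) x x"
    by (auto simp: RL2_def scalar_prod_self_nonneg)
  from x have "hinner (RL2 a b m n) (hzero (RL2 a b m n)) x =
      (\<Sum>i<m. 0) + (\<Sum>i<n. \<integral>s. vec_index (0\<^sub>v n) i * vec_index (snd x s) i \<partial>lebesgue_on {a..b})"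
    by (subst hinner_RL2) (auto simp: RL2_def L2_zero)
  also have "\<dots> = 0"
    by simp
  finally show "hinner (RL2 a b m n) (hzero (RL2 a b m n)) x = 0" .
qed (auto simp: RL2_def L2_zero L2_add L2_scale)

lemma hinner_RL2_diff:
  assumes x: "x \<in> hcarrier (RL2 a b m n)" and y: "y \<in> hcarrier (RL2 a b m n)"
  shows "hinner (RL2 a b m n) (hminus (RL2 a b m n) x y) (hminus (RL2 a b m n) x y)
    = (\<Sum>i<m. (vec_index (fst x) i - vec_index (fst y) i)\<^sup>2)
      + (\<Sum>i<n. \<integral>s. (vec_index (snd x s) i - vec_index (snd y s) i)\<^sup>2 \<partial>lebesgue_on {a..b})"
proof -
  interpret semi_inner_space "RL2 a b m n"
    by (rule semi_inner_space_RL2)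
  let ?d = "hminus (RL2 a b m n) x y"
  have carr: "fst x \<in> carrier_vec m" "fst y \<in> carrier_vec m" "snd x \<in> L2 a b n" "snd y \<in> L2 a b n"
    using x y by (auto simp: RL2_def)
  have "vec_index (fst ?d) i = vec_index (fst x) i - vec_index (fst y) i" if "i < m" for i
    using that carr by (auto simp: hminus_def RL2_def)
  moreover have "vec_index (snd ?d s) i = vec_index (snd x s) i - vec_index (snd y s) i"
    if "i < n" "s \<in> {a..b}" for i s
    using that L2_carrier[OF carr(3) that(2)] L2_carrier[OF carr(4) that(2)]
    by (auto simp: hminus_def RL2_def)
  then have "(\<integral>s. vec_index (snd ?d s) i * vec_index (snd ?d s) i \<partial>lebesgue_on {a..b})
      = (\<integral>s. (vec_index (snd x s) i - vec_index (snd y s) i)\<^sup>2 \<partial>lebesgue_on {a..b})"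
    if "i < n" for i
    using that by (intro Bochner_Integration.integral_cong) (auto simp: power2_eq_square)
  ultimately show ?thesis
    using x y by (simp add: hinner_RL2 power2_eq_square)
qed

text \<open>The form is a sum of squares over the $m$ real and the $n$ function components, so a Cauchy sequence
  is Cauchy in every component, and the componentwise limits assemble to a limit of the sequence.\<close>

theorem hilbert_space_RL2: "hilbert_space (RL2 a b m n)"
proof -
  let ?H = "RL2 a b m n" and ?M = "lebesgue_on {a..b}"
  interpret semi_inner_space ?H
    by (rule semi_inner_space_RL2)
  show ?thesis
  proof
    fix X :: "nat \<Rightarrow> rl2"
    assume X: "\<And>k. X k \<in> hcarrier ?H"
      and Cauchy: "\<And>e. e > 0 \<Longrightarrow> \<exists>N. \<forall>k\<ge>N. \<forall>l\<ge>N. hnorm ?H (hminus ?H (X k) (X l)) < e"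
    define p where "p i k = vec_index (fst (X k)) i" for i k
    define q where "q i k s = vec_index (snd (X k) s) i" for i k s
    have q_meas: "q i k \<in> borel_measurable ?M" and q_sq: "integrable ?M (\<lambda>s. (q i k s)\<^sup>2)"
      if "i < n" for i k
      using X[of k] that by (auto simp: RL2_def L2_def q_def[abs_def])
    have inner_diff: "hinner ?H (hminus ?H (X k) (X l)) (hminus ?H (X k) (X l))
        = (\<Sum>i<m. (p i k - p i l)\<^sup>2) + (\<Sum>i<n. \<integral>s. (q i k s - q i l s)\<^sup>2 \<partial>?M)" for k l
      unfolding p_def q_def by (rule hinner_RL2_diff[OF X X])
    have small: "\<exists>N. \<forall>k\<ge>N. \<forall>l\<ge>N. (\<Sum>i<m. (p i k - p i l)\<^sup>2)
        + (\<Sum>i<n. \<integral>s. (q i k s - q i l s)\<^sup>2 \<partial>?M) < e" if "e > 0" for e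
    proof -
      obtain N where N: "\<And>k l. \<lbrakk>k \<ge> N; l \<ge> N\<rbrakk> \<Longrightarrow> hnorm ?H (hminus ?H (X k) (X l)) < sqrt e"
        using Cauchy[of "sqrt e"] \<open>e > 0\<close> by auto
      then show ?thesis
        unfolding hnorm_def inner_diff by (intro exI[of _ N]) auto
    qed
    have "convergent (p i)" if i: "i < m" for i
      unfolding Cauchy_convergent_iff[symmetric]
    proof (rule metric_CauchyI)
      fix e :: real assume "e > 0"
      then obtain N where N: "\<And>k l. \<lbrakk>k \<ge> N; l \<ge> N\<rbrakk> \<Longrightarrow> (\<Sum>i<m. (p i k - p i l)\<^sup>2)
          + (\<Sum>i<n. \<integral>s. (q i k s - q i l s)\<^sup>2 \<partial>?M) < e\<^sup>2"
        using small[of "e\<^sup>2"] by auto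
      have "dist (p i k) (p i l) < e" if "k \<ge> N" "l \<ge> N" for k l
      proof -
        have "(p i k - p i l)\<^sup>2 \<le> (\<Sum>i<m. (p i k - p i l)\<^sup>2)"
          using i by (intro member_le_sum) auto
        also have "\<dots> \<le> (\<Sum>i<m. (p i k - p i l)\<^sup>2) + (\<Sum>i<n. \<integral>s. (q i k s - q i l s)\<^sup>2 \<partial>?M)"
          by (simp add: sum_nonneg)
        also have "\<dots> < e\<^sup>2"
          by (rule N[OF that])
        finally have "(dist (p i k) (p i l))\<^sup>2 < e\<^sup>2"
          by (simp add: dist_real_def)
        then show ?thesis
          by (rule power2_less_imp_less) (use \<open>e > 0\<close> in simp)
      qed
      then show "\<exists>N. \<forall>k\<ge>N. \<forall>l\<ge>N. dist (p i k) (p i l) < e"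
        by blast
    qed
    then have "\<forall>i\<in>{..<m}. \<exists>P. p i \<longlonglongrightarrow> P"
      by (simp add: convergent_def)
    then obtain P where P: "\<And>i. i < m \<Longrightarrow> p i \<longlonglongrightarrow> P i"
      unfolding bchoice_iff by auto
    have "\<exists>g\<in>borel_measurable ?M. integrable ?M (\<lambda>s. (g s)\<^sup>2) \<and>
        (\<lambda>k. \<integral>s. (q i k s - g s)\<^sup>2 \<partial>?M) \<longlonglongrightarrow> 0" if i: "i < n" for i
    proof (rule L2_sequence_limit_real)
      show "finite_measure ?M"
        by (rule finite_measure_lebesgue_on) simp
      fix e :: real assume "e > 0"
      then obtain N where N: "\<And>k l. \<lbrakk>k \<ge> N; l \<ge> N\<rbrakk> \<Longrightarrow> (\<Sum>i<m. (p i k - p i l)\<^sup>2)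
          + (\<Sum>i<n. \<integral>s. (q i k s - q i l s)\<^sup>2 \<partial>?M) < e"
        using small[of e] by auto
      have "(\<integral>s. (q i k s - q i l s)\<^sup>2 \<partial>?M) < e" if "k \<ge> N" "l \<ge> N" for k l
      proof -
        have "(\<integral>s. (q i k s - q i l s)\<^sup>2 \<partial>?M) \<le> (\<Sum>i<n. \<integral>s. (q i k s - q i l s)\<^sup>2 \<partial>?M)"
          using i by (intro member_le_sum) auto
        also have "\<dots> \<le> (\<Sum>i<m. (p i k - p i l)\<^sup>2) + (\<Sum>i<n. \<integral>s. (q i k s - q i l s)\<^sup>2 \<partial>?M)"
          by (simp add: sum_nonneg)
        also have "\<dots> < e"
          by (rule N[OF that])
        finally show ?thesis .
      qed
      then show "\<exists>N. \<forall>k\<ge>N. \<forall>l\<ge>N. (\<integral>s. (q i k s - q i l s)\<^sup>2 \<partial>?M) < e"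
        by blast
    qed (use i q_meas q_sq in auto)
    then have "\<forall>i\<in>{..<n}. \<exists>g. g \<in> borel_measurable ?M \<and> integrable ?M (\<lambda>s. (g s)\<^sup>2) \<and>
        (\<lambda>k. \<integral>s. (q i k s - g s)\<^sup>2 \<partial>?M) \<longlonglongrightarrow> 0"
      by blast
    then obtain g where "\<forall>i\<in>{..<n}. g i \<in> borel_measurable ?M \<and> integrable ?M (\<lambda>s. (g i s)\<^sup>2) \<and>
        (\<lambda>k. \<integral>s. (q i k s - g i s)\<^sup>2 \<partial>?M) \<longlonglongrightarrow> 0"
      unfolding bchoice_iff by blast
    then have g: "\<And>i. i < n \<Longrightarrow> g i \<in> borel_measurable ?M"
        "\<And>i. i < n \<Longrightarrow> integrable ?M (\<lambda>s. (g i s)\<^sup>2)"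
        "\<And>i. i < n \<Longrightarrow> (\<lambda>k. \<integral>s. (q i k s - g i s)\<^sup>2 \<partial>?M) \<longlonglongrightarrow> 0"
      by simp_all
    define y :: rl2 where "y = (Matrix.vec m P, \<lambda>s. Matrix.vec n (\<lambda>i. g i s))"
    have "(\<lambda>s. Matrix.vec n (\<lambda>i. g i s)) \<in> L2 a b n"
      by (rule L2I[where c = g]) (use g in auto)
    then have y: "y \<in> hcarrier ?H"
      by (simp add: y_def RL2_def)
    have "hinner ?H (hminus ?H (X k) y) (hminus ?H (X k) y)
        = (\<Sum>i<m. (p i k - P i)\<^sup>2) + (\<Sum>i<n. \<integral>s. (q i k s - g i s)\<^sup>2 \<partial>?M)" for k
      by (subst hinner_RL2_diff[OF X y]) (simp add: p_def q_def y_def)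
    moreover have "(\<lambda>k. (\<Sum>i<m. (p i k - P i)\<^sup>2) + (\<Sum>i<n. \<integral>s. (q i k s - g i s)\<^sup>2 \<partial>?M))
        \<longlonglongrightarrow> (\<Sum>i<m. (P i - P i)\<^sup>2) + (\<Sum>i<n. 0)"
      using P g(3) by (intro tendsto_intros) auto
    ultimately have "(\<lambda>k. hinner ?H (hminus ?H (X k) y) (hminus ?H (X k) y)) \<longlonglongrightarrow> 0"
      by simp
    from tendsto_real_sqrt[OF this] have "(\<lambda>k. hnorm ?H (hminus ?H (X k) y)) \<longlonglongrightarrow> 0"
      by (simp add: hnorm_def)
    with y show "\<exists>y\<in>hcarrier ?H. (\<lambda>k. hnorm ?H (hminus ?H (X k) y)) \<longlonglongrightarrow> 0"
      by blast
  qed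
qed

lemma hinner_RL2_Rn:
  assumes "x \<in> hcarrier (RL2 a b k 0)" "y \<in> hcarrier (RL2 a b k 0)"
  shows "hinner (RL2 a b k 0) x y = hinner (Rn k) (fst x) (fst y)"
  using assms by (subst hinner_RL2) (auto simp: RL2_def Rn_def scalar_prod_eq_sum)

lemma Rn_embed_closed:
  "x \<in> hcarrier (Rn k) \<Longrightarrow> (x, \<lambda>s. 0\<^sub>v 0) \<in> hcarrier (RL2 a b k 0)"
  by (simp add: RL2_def Rn_def L2_zero del: zero_vec_zero)

text \<open>$RL_2^{k,0}$ is a copy of $R^k$, so its completeness carries over.\<close>

theorem hilbert_space_Rn: "hilbert_space (Rn k)"
proof -
  interpret Rn: semi_inner_space "Rn k"
    by (rule semi_inner_space_Rn)
  interpret RL2: hilbert_space "RL2 0 0 k 0"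
    by (rule hilbert_space_RL2)
  have norm_eq: "hnorm (RL2 0 0 k 0) (hminus (RL2 0 0 k 0) x y) = hnorm (Rn k) (hminus (Rn k) (fst x) (fst y))"
    if "x \<in> hcarrier (RL2 0 0 k 0)" "y \<in> hcarrier (RL2 0 0 k 0)" for x y
  proof -
    have "fst (hminus (RL2 0 0 k 0) x y) = hminus (Rn k) (fst x) (fst y)"
      by (simp add: hminus_def RL2_def Rn_def)
    then show ?thesis
      using that RL2.minus_closed[OF that] by (simp add: hnorm_def hinner_RL2_Rn)
  qed
  show ?thesis
  proof
    fix X :: "nat \<Rightarrow> rvec"
    assume X: "\<And>j. X j \<in> hcarrier (Rn k)"
      and Cauchy: "\<And>e. e > 0 \<Longrightarrow> \<exists>N. \<forall>i\<ge>N. \<forall>j\<ge>N. hnorm (Rn k) (hminus (Rn k) (X i) (X j)) < e"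
    have "\<exists>y\<in>hcarrier (RL2 0 0 k 0).
        (\<lambda>j. hnorm (RL2 0 0 k 0) (hminus (RL2 0 0 k 0) (X j, \<lambda>s. 0\<^sub>v 0) y)) \<longlonglongrightarrow> 0"
      by (rule RL2.complete) (use X Cauchy in \<open>auto simp: norm_eq Rn_embed_closed simp del: zero_vec_zero\<close>)
    then show "\<exists>y\<in>hcarrier (Rn k). (\<lambda>j. hnorm (Rn k) (hminus (Rn k) (X j) y)) \<longlonglongrightarrow> 0"
      using X by (auto simp: norm_eq Rn_embed_closed simp del: zero_vec_zero)
        (auto simp: RL2_def Rn_def)
  qed
qed

lemma PI_op_from_Rn_bounded:
  assumes "PI_op_from_Rn a b k m n F"
  shows "bounded_op (Rn k) (RL2 a b m n) F"
proof -
  let ?E = "RL2 a b k 0" and ?H = "RL2 a b m n"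
  let ?e = "\<lambda>x. (x, \<lambda>s::real. 0\<^sub>v 0 :: rvec)"
  have F: "bounded_op ?E ?H (\<lambda>x. F (fst x))"
    using assms by (simp add: PI_op_from_Rn_def PI_op_def)
  have norm_eq: "hnorm ?E (?e x) = hnorm (Rn k) x" if "x \<in> hcarrier (Rn k)" for x
    using that by (simp add: hnorm_def hinner_RL2_Rn Rn_embed_closed del: zero_vec_zero)
  from F obtain M where M: "\<And>x. x \<in> hcarrier ?E \<Longrightarrow> hnorm ?H (F (fst x)) \<le> M * hnorm ?E x"
    unfolding bounded_op_def by blast
  have "hadd (Rn k) x y = fst (hadd ?E (?e x) (?e y))"
    "hscale (Rn k) c x = fst (hscale ?E c (?e x))" for x y c
    by (simp_all add: RL2_def Rn_def)
  moreover have "heq ?H (F (fst (hadd ?E x y))) (hadd ?H (F (fst x)) (F (fst y)))"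
    "heq ?H (F (fst (hscale ?E c x))) (hscale ?H c (F (fst x)))"
    "F (fst x) \<in> hcarrier ?H"
    if "x \<in> hcarrier ?E" "y \<in> hcarrier ?E" for x y c
    using F that unfolding bounded_op_def by blast+
  from this[OF Rn_embed_closed Rn_embed_closed]
  have "heq ?H (F (fst (hadd ?E (?e x) (?e y)))) (hadd ?H (F x) (F y))"
    "heq ?H (F (fst (hscale ?E c (?e x)))) (hscale ?H c (F x))"
    "F x \<in> hcarrier ?H"
    if "x \<in> hcarrier (Rn k)" "y \<in> hcarrier (Rn k)" for x y c
    using that by auto
  moreover have "hnorm ?H (F x) \<le> M * hnorm (Rn k) x" if "x \<in> hcarrier (Rn k)" for x
    using M[OF Rn_embed_closed[OF that]] norm_eq[OF that] by simp
  ultimately show ?thesis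
    unfolding bounded_op_def by (intro conjI ballI allI exI[of _ M]) simp_all
qed

lemma PI_op_to_Rn_bounded:
  assumes "PI_op_to_Rn a b m n k F"
  shows "bounded_op (RL2 a b m n) (Rn k) F"
proof -
  let ?E = "RL2 a b k 0" and ?H = "RL2 a b m n"
  let ?e = "\<lambda>x. (x, \<lambda>s::real. 0\<^sub>v 0 :: rvec)"
  interpret H: semi_inner_space ?H
    by (rule semi_inner_space_RL2)
  interpret E: semi_inner_space ?E
    by (rule semi_inner_space_RL2)
  interpret Rn: semi_inner_space "Rn k"
    by (rule semi_inner_space_Rn)
  interpret HE: semi_inner_pair ?H ?E ..
  interpret HR: semi_inner_pair ?H "Rn k" ..
  have F: "bounded_op ?H ?E (\<lambda>x. ?e (F x))"
    using assms by (simp add: PI_op_to_Rn_def PI_op_def)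
  note cl = bounded_op_closed[OF F]
  have cl': "F x \<in> hcarrier (Rn k)" if "x \<in> hcarrier ?H" for x
    using cl[OF that] by (simp add: RL2_def Rn_def)
  have inner_eq: "hinner (Rn k) u v = hinner ?E (?e u) (?e v)"
    if "u \<in> hcarrier (Rn k)" "v \<in> hcarrier (Rn k)" for u v
    using that by (simp add: hinner_RL2_Rn Rn_embed_closed del: zero_vec_zero)
  from F obtain M where M: "\<And>x. x \<in> hcarrier ?H \<Longrightarrow> hnorm ?E (?e (F x)) \<le> M * hnorm ?H x"
    unfolding bounded_op_def by blast
  show ?thesis
  proof (rule HR.bounded_opI)
    fix x assume x: "x \<in> hcarrier ?H"
    show "hnorm (Rn k) (F x) \<le> M * hnorm ?H x"
      using M[OF x] inner_eq[OF cl'[OF x] cl'[OF x]] by (simp add: hnorm_def)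
  qed (simp_all add: cl' inner_eq HE.inner_op_add[OF F] HE.inner_op_scale[OF F] Rn_embed_closed
      del: zero_vec_zero)
qed

section \<open>Matrices as operators and as quadratic forms\<close>

lemma mat_mult_bounded:
  fixes D :: rmat
  assumes D: "D \<in> carrier_mat p q"
  shows "bounded_op (Rn q) (Rn p) ((*\<^sub>v) D)"
proof -
  interpret P: semi_inner_space "Rn p" by (rule semi_inner_space_Rn)
  interpret Q: semi_inner_space "Rn q" by (rule semi_inner_space_Rn)
  interpret semi_inner_pair "Rn q" "Rn p" ..
  define M where "M = (\<Sum>i<p. (hnorm (Rn q) (row D i))\<^sup>2)"
  have bound: "hnorm (Rn p) (D *\<^sub>v x) \<le> sqrt M * hnorm (Rn q) x" if x: "x \<in> hcarrier (Rn q)" for x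
  proof -
    have row: "row D i \<in> hcarrier (Rn q)" for i
      using D by (auto simp: Rn_def)
    have "hinner (Rn p) (D *\<^sub>v x) (D *\<^sub>v x) = (\<Sum>i<p. (hinner (Rn q) (row D i) x)\<^sup>2)"
      using D x by (auto simp: Rn_def scalar_prod_eq_sum[of "D *\<^sub>v x" p] power2_eq_square)
    also have "\<dots> \<le> (\<Sum>i<p. (hnorm (Rn q) (row D i) * hnorm (Rn q) x)\<^sup>2)"
    proof (rule sum_mono)
      fix i
      show "(hinner (Rn q) (row D i) x)\<^sup>2 \<le> (hnorm (Rn q) (row D i) * hnorm (Rn q) x)\<^sup>2"
        using power_mono[OF Q.cauchy_schwarz[OF row[of i] x], of 2] by simp
    qed
    also have "\<dots> = M * (hnorm (Rn q) x)\<^sup>2"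
      by (simp add: M_def power_mult_distrib sum_distrib_right)
    also have "\<dots> = M * hinner (Rn q) x x"
      using x by (simp add: Q.hnorm_power2)
    finally show ?thesis
      unfolding hnorm_def by (simp flip: real_sqrt_mult)
  qed
  show ?thesis
  proof (rule bounded_opI[OF _ _ _ bound])
    fix x y z assume "x \<in> hcarrier (Rn q)" "y \<in> hcarrier (Rn q)" "z \<in> hcarrier (Rn p)"
    then show "hinner (Rn p) (D *\<^sub>v hadd (Rn q) x y) z
        = hinner (Rn p) (D *\<^sub>v x) z + hinner (Rn p) (D *\<^sub>v y) z"
      using D by (auto simp: Rn_def mult_add_distrib_mat_vec add_scalar_prod_distrib[of _ p])
  next
    fix c x z assume "x \<in> hcarrier (Rn q)" "z \<in> hcarrier (Rn p)"
    then show "hinner (Rn p) (D *\<^sub>v hscale (Rn q) c x) z = c * hinner (Rn p) (D *\<^sub>v x) z"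
      using D by (auto simp: Rn_def mult_mat_vec)
  qed (use D in \<open>auto simp: Rn_def\<close>)
qed

text \<open>Evaluating the form on $u_j e_i - u_i e_j$ and summing over all $i, j$ gives exactly twice the
  difference of the two sides.\<close>

lemma psd_quadratic_form_le_trace:
  fixes W :: rmat
  assumes W: "W \<in> carrier_mat k k"
    and psd: "\<And>u. u \<in> carrier_vec k \<Longrightarrow> 0 \<le> scalar_prod u (W *\<^sub>v u)"
    and u: "u \<in> carrier_vec k"
  shows "scalar_prod u (W *\<^sub>v u) \<le> mat_trace W * scalar_prod u u"
proof -
  define q where "q = scalar_prod u (W *\<^sub>v u)"
  define w where "w i j = W $$ (i, j)" for i j
  define c where "c i = vec_index u i" for i
  have form: "scalar_prod x (W *\<^sub>v y) = (\<Sum>i<k. \<Sum>j<k. vec_index x i * w i j * vec_index y j)"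
    if "x \<in> carrier_vec k" "y \<in> carrier_vec k" for x y
  proof -
    have "scalar_prod x (W *\<^sub>v y) = (\<Sum>i<k. vec_index x i * scalar_prod (row W i) y)"
      using W that by (subst scalar_prod_eq_sum[of _ k]) auto
    also have "\<dots> = (\<Sum>i<k. vec_index x i * (\<Sum>j<k. w i j * vec_index y j))"
      using W that by (intro sum.cong refl) (auto simp: scalar_prod_eq_sum[of y k] w_def)
    finally show ?thesis
      by (simp add: sum_distrib_left mult.assoc)
  qed
  have minor: "0 \<le> (c j)\<^sup>2 * w i i + (c i)\<^sup>2 * w j j - c i * c j * w i j - c i * c j * w j i"
    if i: "i < k" and j: "j < k" for i j
  proof -
    define e where "e l = (unit_vec k l :: rvec)" for l
    have e: "e l \<in> carrier_vec k" for l
      by (simp add: e_def)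
    let ?v = "c j \<cdot>\<^sub>v e i - c i \<cdot>\<^sub>v e j"
    have v: "?v \<in> carrier_vec k"
      using e by auto
    have unit: "scalar_prod (e l) (W *\<^sub>v e l') = w l l'" if "l < k" "l' < k" for l l'
      using that W by (simp add: e_def w_def)
    have "W *\<^sub>v ?v = c j \<cdot>\<^sub>v (W *\<^sub>v e i) - c i \<cdot>\<^sub>v (W *\<^sub>v e j)"
      using W e by (simp add: mult_minus_distrib_mat_vec[of _ k k] mult_mat_vec[of _ k k])
    then have "scalar_prod ?v (W *\<^sub>v ?v) = (c j)\<^sup>2 * w i i + (c i)\<^sup>2 * w j j
        - c i * c j * w i j - c i * c j * w j i"
      using W e i j
      by (simp add: scalar_prod_minus_distrib[of _ k] minus_scalar_prod_distrib[of _ k]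
          unit algebra_simps power2_eq_square)
    with psd[OF v] show ?thesis by simp
  qed
  have q1: "(\<Sum>i<k. \<Sum>j<k. c i * c j * w i j) = q"
    using u by (simp add: q_def form c_def mult_ac)
  have q2: "(\<Sum>i<k. \<Sum>j<k. c i * c j * w j i) = q"
    by (subst sum.swap) (simp add: q1[symmetric] mult_ac)
  have uu: "(\<Sum>j<k. (c j)\<^sup>2) = scalar_prod u u"
    using u by (simp add: scalar_prod_eq_sum[of _ k] c_def power2_eq_square)
  have tr: "(\<Sum>i<k. w i i) = mat_trace W"
    using W by (simp add: mat_trace_def w_def)
  have t1: "(\<Sum>i<k. \<Sum>j<k. (c j)\<^sup>2 * w i i) = mat_trace W * scalar_prod u u"
    by (simp add: uu tr flip: sum_distrib_left sum_distrib_right)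
  have t2: "(\<Sum>i<k. \<Sum>j<k. (c i)\<^sup>2 * w j j) = mat_trace W * scalar_prod u u"
    by (simp add: uu tr flip: sum_distrib_left sum_distrib_right)
  have "0 \<le> (\<Sum>i<k. \<Sum>j<k. (c j)\<^sup>2 * w i i + (c i)\<^sup>2 * w j j - c i * c j * w i j - c i * c j * w j i)"
    by (intro sum_nonneg minor) auto
  also have "\<dots> = 2 * (mat_trace W * scalar_prod u u) - 2 * q"
    by (simp add: sum.distrib sum_subtractf q1 q2 t1 t2)
  finally show ?thesis
    by (simp add: q_def)
qed

section \<open>Dissipation inequalities\<close>

text \<open>With the difference quotient $q$ of $v$ at $t$, symmetry of \<open>P\<close> gives the exact identity
  $(V(\tau) - V(t)) / (\tau - t) = 2\langle q, P v(t)\rangle + (\tau - t)\langle q, P q\rangle$,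
  in which $q$ tends to $v'$ and hence stays bounded.\<close>

lemma has_hderiv_quadratic_form:
  assumes H: "semi_inner_space H" and P: "bounded_op H H P"
    and sym: "\<And>x y. \<lbrakk>x \<in> hcarrier H; y \<in> hcarrier H\<rbrakk> \<Longrightarrow> hinner H (P x) y = hinner H x (P y)"
    and v: "\<And>\<tau>. \<tau> \<ge> 0 \<Longrightarrow> v \<tau> \<in> hcarrier H"
    and deriv: "has_hderiv H v v' t" and t: "t \<ge> 0"
  shows "((\<lambda>\<tau>. hinner H (v \<tau>) (P (v \<tau>))) has_real_derivative 2 * hinner H v' (P (v t)))
    (at t within {0..})"
proof -
  interpret semi_inner_space H by fact
  interpret HH: semi_inner_pair H H ..
  note [simp] = bounded_op_closed[OF P]
  have v': "v' \<in> hcarrier H"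
    using deriv by (simp add: has_hderiv_def)
  have vt: "v t \<in> hcarrier H"
    using v t by simp
  obtain M where M: "M > 0" "\<And>x. x \<in> hcarrier H \<Longrightarrow> hnorm H (P x) \<le> M * hnorm H x"
    using P by (rule HH.bounded_opE) blast
  define V where "V \<tau> = hinner H (v \<tau>) (P (v \<tau>))" for \<tau>
  define q where "q \<tau> = hscale H (1 / (\<tau> - t)) (hminus H (v \<tau>) (v t))" for \<tau>
  define N where "N \<tau> = hnorm H (hminus H (q \<tau>) v')" for \<tau>
  have N: "(N \<longlongrightarrow> 0) (at t within {0..})"
    using deriv by (simp add: has_hderiv_def N_def[abs_def] q_def)
  define B where "B \<tau> = 2 * (N \<tau> * hnorm H (P (v t)))
    + \<bar>\<tau> - t\<bar> * (M * (N \<tau> + hnorm H v')\<^sup>2)" for \<tau>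
  have bound: "\<bar>(V \<tau> - V t) / (\<tau> - t) - 2 * hinner H v' (P (v t))\<bar> \<le> B \<tau>"
    if "\<tau> \<ge> 0" "\<tau> \<noteq> t" for \<tau>
  proof -
    let ?d = "hminus H (v \<tau>) (v t)"
    have vs: "v \<tau> \<in> hcarrier H"
      using v that by simp
    have q: "q \<tau> \<in> hcarrier H"
      using vs vt by (simp add: q_def)
    have "hinner H (v t) (P (v \<tau>)) = hinner H (v \<tau>) (P (v t))"
      using sym[OF vt vs] vs vt by (simp add: inner_commute[of "v \<tau>"])
    then have "V \<tau> - V t = 2 * hinner H ?d (P (v t)) + hinner H ?d (P ?d)"
      using vs vt HH.inner_op_minus[OF P vs vt, of "v \<tau>"] HH.inner_op_minus[OF P vs vt, of "v t"]
      by (simp add: V_def inner_commute[of _ "P ?d"]) (simp add: inner_commute)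
    moreover have "hinner H (q \<tau>) (P (v t)) = hinner H ?d (P (v t)) / (\<tau> - t)"
      using vs vt by (simp add: q_def)
    moreover have "hinner H (q \<tau>) (P (q \<tau>)) = hinner H ?d (P ?d) / (\<tau> - t)\<^sup>2"
    proof -
      have "hinner H (q \<tau>) (P (q \<tau>)) = hinner H (P (hscale H (1 / (\<tau> - t)) ?d)) (q \<tau>)"
        using q by (simp add: inner_commute[of "q \<tau>"] flip: q_def)
      also have "\<dots> = hinner H (P ?d) ?d / (\<tau> - t)\<^sup>2"
        using q vs vt by (simp add: HH.inner_op_scale[OF P]) (simp add: q_def power2_eq_square)
      also have "hinner H (P ?d) ?d = hinner H ?d (P ?d)"
        using vs vt by (intro inner_commute) auto
      finally show ?thesis .
    qed
    ultimately have "(V \<tau> - V t) / (\<tau> - t)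
        = 2 * hinner H (q \<tau>) (P (v t)) + (\<tau> - t) * hinner H (q \<tau>) (P (q \<tau>))"
      using that by (simp add: add_divide_distrib power2_eq_square)
    then have "(V \<tau> - V t) / (\<tau> - t) - 2 * hinner H v' (P (v t))
        = 2 * hinner H (hminus H (q \<tau>) v') (P (v t)) + (\<tau> - t) * hinner H (q \<tau>) (P (q \<tau>))"
      using q v' vt by simp
    also have "\<bar>\<dots>\<bar> \<le> 2 * \<bar>hinner H (hminus H (q \<tau>) v') (P (v t))\<bar>
        + \<bar>\<tau> - t\<bar> * \<bar>hinner H (q \<tau>) (P (q \<tau>))\<bar>"
      by (rule order_trans[OF abs_triangle_ineq]) (simp add: abs_mult)
    also have "\<dots> \<le> B \<tau>"
      unfolding B_def
    proof (intro add_mono mult_left_mono)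
      show "\<bar>hinner H (hminus H (q \<tau>) v') (P (v t))\<bar> \<le> N \<tau> * hnorm H (P (v t))"
        unfolding N_def using q v' vt by (intro cauchy_schwarz) auto
      have "hnorm H (q \<tau>) = hnorm H (hadd H (hminus H (q \<tau>) v') v')"
        using q v' by (simp add: hnorm_def)
      also have "\<dots> \<le> N \<tau> + hnorm H v'"
        unfolding N_def using q v' by (intro hnorm_add_le) auto
      finally have q_le: "hnorm H (q \<tau>) \<le> N \<tau> + hnorm H v'" .
      have "\<bar>hinner H (q \<tau>) (P (q \<tau>))\<bar> \<le> hnorm H (q \<tau>) * hnorm H (P (q \<tau>))"
        using q by (intro cauchy_schwarz) auto
      also have "\<dots> \<le> hnorm H (q \<tau>) * (M * hnorm H (q \<tau>))"
        using q M by (intro mult_left_mono) auto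
      also have "\<dots> = M * (hnorm H (q \<tau>))\<^sup>2"
        by (simp add: power2_eq_square)
      also have "\<dots> \<le> M * (N \<tau> + hnorm H v')\<^sup>2"
        using q_le q M(1) by (intro mult_left_mono power_mono) auto
      finally show "\<bar>hinner H (q \<tau>) (P (q \<tau>))\<bar> \<le> M * (N \<tau> + hnorm H v')\<^sup>2" .
    qed auto
    finally show ?thesis .
  qed
  have "((\<lambda>\<tau>. \<bar>\<tau> - t\<bar>) \<longlongrightarrow> \<bar>t - t\<bar>) (at t within {0..})"
    by (intro tendsto_intros)
  then have "(B \<longlongrightarrow> 2 * (0 * hnorm H (P (v t))) + 0 * (M * (0 + hnorm H v')\<^sup>2)) (at t within {0..})"
    unfolding B_def[abs_def] by (intro tendsto_intros N) simp_all
  then have B: "(B \<longlongrightarrow> 0) (at t within {0..})"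
    by simp
  have "((\<lambda>\<tau>. (V \<tau> - V t) / (\<tau> - t) - 2 * hinner H v' (P (v t))) \<longlongrightarrow> 0) (at t within {0..})"
  proof (rule Lim_null_comparison[OF _ B])
    show "\<forall>\<^sub>F \<tau> in at t within {0..}. norm ((V \<tau> - V t) / (\<tau> - t) - 2 * hinner H v' (P (v t))) \<le> B \<tau>"
      using bound by (auto simp: eventually_at_filter intro: always_eventually)
  qed
  then show ?thesis
    by (simp add: has_field_derivative_iff LIM_zero_iff V_def)
qed

text \<open>\<open>V\<close> is differentiable everywhere, but its derivative need not be Lebesgue integrable. The
  Henstock-Kurzweil fundamental theorem of calculus applies nevertheless, and its integral can be
  compared with that of \<open>\<zeta>\<close> on every $[0,T]$; monotone convergence gives the half-line.\<close>

lemma integral_le_of_dissipation: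
  fixes V V' \<zeta> :: "real \<Rightarrow> real"
  assumes deriv: "\<And>t. t \<ge> 0 \<Longrightarrow> (V has_real_derivative V' t) (at t within {0..})"
    and nonneg: "\<And>t. t \<ge> 0 \<Longrightarrow> 0 \<le> V t"
    and \<zeta>: "\<And>t. 0 \<le> \<zeta> t"
    and dissipation: "\<And>t. t \<ge> 0 \<Longrightarrow> V' t + \<zeta> t \<le> 0"
    and int: "\<And>T. T \<ge> 0 \<Longrightarrow> integrable (lebesgue_on {0..T}) \<zeta>"
  shows "integrable (lebesgue_on {0..}) \<zeta>" and "(\<integral>t. \<zeta> t \<partial>lebesgue_on {0..}) \<le> V 0"
proof -
  have bound: "(\<integral>t. \<zeta> t \<partial>lebesgue_on {0..T}) \<le> V 0" if T: "T \<ge> 0" for T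
  proof -
    have "(V' has_integral (V T - V 0)) {0..T}"
    proof (rule fundamental_theorem_of_calculus[OF T])
      fix t assume "t \<in> {0..T}"
      then show "(V has_vector_derivative V' t) (at t within {0..T})"
        by (intro has_vector_derivative_within_subset[OF deriv[of t, unfolded
                has_real_derivative_iff_has_vector_derivative]]) auto
    qed
    moreover have "(\<zeta> has_integral (\<integral>t. \<zeta> t \<partial>lebesgue_on {0..T})) {0..T}"
      using int[OF T] by (intro has_integral_integral_lebesgue_on) auto
    then have "((\<lambda>t. - \<zeta> t) has_integral - (\<integral>t. \<zeta> t \<partial>lebesgue_on {0..T})) {0..T}"
      by (rule has_integral_neg)
    ultimately have "V T - V 0 \<le> - (\<integral>t. \<zeta> t \<partial>lebesgue_on {0..T})"
    proof (rule has_integral_le)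
      fix t assume "t \<in> {0..T}"
      then show "V' t \<le> - \<zeta> t"
        using dissipation[of t] by simp
    qed
    then show ?thesis
      using nonneg[OF T] by simp
  qed
  define f where "f i t = indicator {0..real i} t * \<zeta> t" for i t
  define u where "u t = indicator {0..} t * \<zeta> t" for t
  have f_int: "integrable lebesgue (f i)" for i
    using int[of "real i"] by (simp add: integrable_restrict_space f_def[abs_def])
  have f_integral: "integral\<^sup>L lebesgue (f i) = (\<integral>t. \<zeta> t \<partial>lebesgue_on {0..real i})" for i
    by (simp add: integral_restrict_space f_def[abs_def])
  have mono: "f i t \<le> f j t" if "i \<le> j" for i j t
    using that \<zeta>[of t] by (auto simp: f_def indicator_def)
  have lim: "(\<lambda>i. f i t) \<longlonglongrightarrow> u t" for t
  proof (rule tendsto_eventually)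
    obtain n where "t \<le> real n"
      using real_arch_simple by blast
    then show "\<forall>\<^sub>F i in sequentially. f i t = u t"
      by (auto simp: eventually_sequentially f_def u_def indicator_def intro!: exI[of _ n])
  qed
  have "incseq (\<lambda>i. integral\<^sup>L lebesgue (f i))"
    by (intro incseq_SucI integral_mono f_int mono) simp
  then obtain L where L: "(\<lambda>i. integral\<^sup>L lebesgue (f i)) \<longlonglongrightarrow> L"
    by (rule incseq_convergent[of _ "V 0"]) (use bound in \<open>auto simp: f_integral\<close>)
  have u_meas: "u \<in> borel_measurable lebesgue"
    using lim by (rule borel_measurable_LIMSEQ_real) (use f_int in auto)
  have mono': "AE t in lebesgue. mono (\<lambda>i. f i t)"
    using mono by (auto simp: mono_def)
  have lim': "AE t in lebesgue. (\<lambda>i. f i t) \<longlonglongrightarrow> u t"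
    using lim by simp
  have "integrable lebesgue u" and u_eq: "integral\<^sup>L lebesgue u = L"
    using integrable_monotone_convergence[OF f_int mono' lim' L u_meas]
      integral_monotone_convergence[OF f_int mono' lim' L u_meas] by auto
  then show "integrable (lebesgue_on {0..}) \<zeta>"
    by (simp add: integrable_restrict_space u_def[abs_def])
  have "L \<le> V 0"
    by (rule LIMSEQ_le_const2[OF L]) (use bound in \<open>auto simp: f_integral\<close>)
  then show "(\<integral>t. \<zeta> t \<partial>lebesgue_on {0..}) \<le> V 0"
    using u_eq by (simp add: integral_restrict_space u_def[abs_def])
qed

section \<open>The estimation error system and its $H_2$-norm\<close>

lemma coercive_of_loewner_le:
  assumes H: "semi_inner_space H" and le: "loewner_le H (op_scale H \<epsilon> id) P"
    and x: "x \<in> hcarrier H"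
  shows "\<epsilon> * hinner H x x \<le> hinner H x (P x)"
proof -
  interpret semi_inner_space H by fact
  have "P x \<in> hcarrier H"
    using le x by (auto simp: loewner_le_def selfadjoint_op_def dest: bounded_op_closed[of H H P])
  moreover have "0 \<le> hinner H x ((P \<boxplus>\<^bsub>H\<^esub> op_neg H (op_scale H \<epsilon> id)) x)"
    using le x by (simp add: loewner_le_def psd_op_def)
  ultimately show ?thesis
    using x by (simp add: op_add_def op_neg_def op_scale_def)
qed

text \<open>The quadratic form of the block operator. The two off-diagonal blocks contribute equally, which is
  where the existence of the adjoint of \<open>G\<close> enters.\<close>

lemma block_op_nonneg_form:
  assumes H: "hilbert_space H" and U: "hilbert_space U"
    and P: "bounded_op H H P" and G: "bounded_op U H G" and W: "\<And>u. u \<in> hcarrier U \<Longrightarrow> W u \<in> hcarrier U"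
    and psd: "loewner_le (prod_hspace H U) (op_zero (prod_hspace H U))
      (block_op H U P (op_neg H G) (op_neg U (adj U H G)) W)"
    and y: "y \<in> hcarrier H" and u: "u \<in> hcarrier U"
  shows "0 \<le> hinner H y (P y) - 2 * hinner H y (G u) + hinner U u (W u)"
proof -
  interpret H: hilbert_space H by fact
  interpret U: hilbert_space U by fact
  note adj = adj_exists[OF U H.semi_inner_space_axioms G]
  have cl: "P y \<in> hcarrier H" "G u \<in> hcarrier H" "adj U H G y \<in> hcarrier U" "W u \<in> hcarrier U"
    using bounded_op_closed[OF P y] bounded_op_closed[OF G u] W[OF u]
      bounded_op_closed[OF conjunct1[OF adj] y] by auto
  have "0 \<le> hinner (prod_hspace H U) (y, u)
      ((block_op H U P (op_neg H G) (op_neg U (adj U H G)) W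
        \<boxplus>\<^bsub>prod_hspace H U\<^esub> op_neg (prod_hspace H U) (op_zero (prod_hspace H U))) (y, u))"
    using psd y u by (simp add: loewner_le_def psd_op_def prod_hspace_def)
  then have "0 \<le> hinner H y (P y) - hinner H y (G u) - hinner U u (adj U H G y) + hinner U u (W u)"
    using y u cl
    by (simp add: op_add_def op_neg_def op_scale_def op_zero_def block_op_def prod_hspace_def)
  moreover have "hinner U u (adj U H G y) = hinner H y (G u)"
    using adj y u cl H.inner_commute[of y "G u"] by auto
  ultimately show ?thesis by simp
qed

text \<open>The operator inequality is the dissipation inequality in disguise. Tested with $x$, its five terms
  combine to $2\langle Ax, PTx\rangle$, $2\langle Z C_2 x, Tx\rangle$ and $|C_1 x|^2$, and
  $\langle Z C_2 x, Tx\rangle = \langle P L C_2 x, Tx\rangle = \langle L C_2 x, PTx\rangle$. The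
  substitution $Z = PL$ is thus what makes the inequality linear in the unknown operators.\<close>

lemma observer_dissipation:
  assumes H: "hilbert_space H" and Y: "hilbert_space Y" and K: "hilbert_space K"
    and bT: "bounded_op H H T" and bA: "bounded_op H H A" and P: "selfadjoint_op H P"
    and bZ: "bounded_op Y H Z" and bC2: "bounded_op H Y C2" and bC1: "bounded_op H K C1"
    and L: "\<And>y. y \<in> hcarrier Y \<Longrightarrow> L y \<in> hcarrier H"
    and PL: "\<And>y. y \<in> hcarrier Y \<Longrightarrow> heq H (P (L y)) (Z y)"
    and lmi: "loewner_le H
          (adj H H T \<circ> P \<circ> A \<boxplus>\<^bsub>H\<^esub> adj H H A \<circ> P \<circ> T
           \<boxplus>\<^bsub>H\<^esub> adj H H T \<circ> Z \<circ> C2 \<boxplus>\<^bsub>H\<^esub> adj H Y C2 \<circ> adj Y H Z \<circ> T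
           \<boxplus>\<^bsub>H\<^esub> adj H K C1 \<circ> C1)
          (op_zero H)"
    and x: "x \<in> hcarrier H"
  shows "2 * hinner H (hadd H (A x) (L (C2 x))) (P (T x)) + hinner K (C1 x) (C1 x) \<le> 0"
proof -
  interpret H: hilbert_space H by fact
  interpret Y: hilbert_space Y by fact
  interpret K: hilbert_space K by fact
  have bP: "bounded_op H H P"
    using P by (simp add: selfadjoint_op_def)
  note aT = adj_exists[OF H H.semi_inner_space_axioms bT]
    and aA = adj_exists[OF H H.semi_inner_space_axioms bA]
    and aC1 = adj_exists[OF H K.semi_inner_space_axioms bC1]
    and aC2 = adj_exists[OF H Y.semi_inner_space_axioms bC2]
    and aZ = adj_exists[OF Y H.semi_inner_space_axioms bZ]
  note sym = selfadjoint_op_symmetric[OF H P]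
  note cl = x bounded_op_closed[OF bT] bounded_op_closed[OF bA] bounded_op_closed[OF bP]
    bounded_op_closed[OF bZ] bounded_op_closed[OF bC1] bounded_op_closed[OF bC2] L
    bounded_op_closed[OF conjunct1[OF aT]] bounded_op_closed[OF conjunct1[OF aA]]
    bounded_op_closed[OF conjunct1[OF aC1]] bounded_op_closed[OF conjunct1[OF aC2]]
    bounded_op_closed[OF conjunct1[OF aZ]]
  have dual: "hinner H x (adj H H T (P (A x))) = hinner H (A x) (P (T x))"
    "hinner H x (adj H H A (P (T x))) = hinner H (A x) (P (T x))"
    "hinner H x (adj H H T (Z (C2 x))) = hinner H (Z (C2 x)) (T x)"
    "hinner H x (adj H Y C2 (adj Y H Z (T x))) = hinner H (Z (C2 x)) (T x)"
    "hinner H x (adj H K C1 (C1 x)) = hinner K (C1 x) (C1 x)"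
    using aT aA aC1 aC2 aZ cl sym[of "A x" "T x"] H.inner_commute[of "T x" "P (A x)"]
      H.inner_commute[of "T x" "Z (C2 x)"] by simp_all
  have "0 \<le> hinner H x ((op_zero H \<boxplus>\<^bsub>H\<^esub> op_neg H
      (adj H H T \<circ> P \<circ> A \<boxplus>\<^bsub>H\<^esub> adj H H A \<circ> P \<circ> T
           \<boxplus>\<^bsub>H\<^esub> adj H H T \<circ> Z \<circ> C2 \<boxplus>\<^bsub>H\<^esub> adj H Y C2 \<circ> adj Y H Z \<circ> T
           \<boxplus>\<^bsub>H\<^esub> adj H K C1 \<circ> C1)) x)"
    using lmi x by (simp add: loewner_le_def psd_op_def)
  then have "2 * hinner H (A x) (P (T x)) + 2 * hinner H (Z (C2 x)) (T x)
      + hinner K (C1 x) (C1 x) \<le> 0"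
    using cl by (simp add: op_add_def op_neg_def op_scale_def op_zero_def dual)
  moreover have "hinner H (L (C2 x)) (P (T x)) = hinner H (Z (C2 x)) (T x)"
    using sym[of "L (C2 x)" "T x"] H.heq_inner_left[OF PL[of "C2 x"], of "T x"] cl by simp
  ultimately show ?thesis
    using cl by simp
qed

theorem corollary9:
  fixes a b \<epsilon> \<gamma> :: real
    and m n nw nz ny :: nat
    and T A P :: "rl2 \<Rightarrow> rl2"
    and B1 Z :: "rvec \<Rightarrow> rl2"
    and C1 C2 :: "rl2 \<Rightarrow> rvec"
    and D21 W :: rmat
    and H :: "rl2 hspace"
    and L G :: "rvec \<Rightarrow> rl2"
  assumes "a \<le> b"
    and H: "H = RL2 a b m n"
    and "PI_op a b m n m n T"
    and "PI_op a b m n m n A"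
    and "PI_op_from_Rn a b nw m n B1"
    and "PI_op_to_Rn a b m n nz C1"
    and "PI_op_to_Rn a b m n ny C2"
    and "D21 \<in> carrier_mat ny nw"
    and "\<epsilon> > 0" and "\<gamma> > 0"
    and "W \<in> carrier_mat nw nw"
    and "PI_op a b m n m n P"
    and "loewner_le H (op_scale H \<epsilon> id) P"
    and "PI_op_from_Rn a b ny m n Z"
    and "loewner_le H
          (adj H H T \<circ> P \<circ> A \<boxplus>\<^bsub>H\<^esub> adj H H A \<circ> P \<circ> T
           \<boxplus>\<^bsub>H\<^esub> adj H H T \<circ> Z \<circ> C2 \<boxplus>\<^bsub>H\<^esub> adj H (Rn ny) C2 \<circ> adj (Rn ny) H Z \<circ> T
           \<boxplus>\<^bsub>H\<^esub> adj H (Rn nz) C1 \<circ> C1)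
          (op_zero H)"
    and G: "G = (P \<circ> B1 \<boxplus>\<^bsub>H\<^esub> Z \<circ> (*\<^sub>v) D21)"
    and "loewner_le (prod_hspace H (Rn nw))
          (op_zero (prod_hspace H (Rn nw)))
          (block_op H (Rn nw)
             P                                     (op_neg H G)
             (op_neg (Rn nw) (adj (Rn nw) H G))    ((*\<^sub>v) W))"
    and "mat_trace W \<le> \<gamma>\<^sup>2"
    and L: "L = op_inv H P \<circ> Z"
    and "H2_norm_defined H nw nz T
          (A \<boxplus>\<^bsub>H\<^esub> L \<circ> C2) (op_neg H (B1 \<boxplus>\<^bsub>H\<^esub> L \<circ> (*\<^sub>v) D21)) C1"
  shows "H2_norm H nw nz T
          (A \<boxplus>\<^bsub>H\<^esub> L \<circ> C2) (op_neg H (B1 \<boxplus>\<^bsub>H\<^esub> L \<circ> (*\<^sub>v) D21)) C1 \<le> ennreal \<gamma>"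
proof -
  note PI = assms(3-7) and D21 = assms(8) and eps = assms(9) and gam = assms(10) and W = assms(11)
    and PI_P = assms(12) and coerc = assms(13) and PI_Z = assms(14) and lmi = assms(15)
    and block = assms(17) and trace = assms(18)
  have HS: "hilbert_space H"
    unfolding H by (rule hilbert_space_RL2)
  interpret H: hilbert_space H by (rule HS)
  interpret HH: semi_inner_pair H H ..
  interpret U: hilbert_space "Rn nw" by (rule hilbert_space_Rn)
  interpret Y: hilbert_space "Rn ny" by (rule hilbert_space_Rn)
  interpret UH: semi_inner_pair "Rn nw" H ..
  interpret YH: semi_inner_pair "Rn ny" H ..
  have bT: "bounded_op H H T" and bA: "bounded_op H H A" and bP: "bounded_op H H P"
    using PI PI_P unfolding H PI_op_def by blast+
  have bB1: "bounded_op (Rn nw) H B1" and bZ: "bounded_op (Rn ny) H Z"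
    using PI PI_Z unfolding H by (auto intro: PI_op_from_Rn_bounded)
  have bC1: "bounded_op H (Rn nz) C1" and bC2: "bounded_op H (Rn ny) C2"
    using PI unfolding H by (auto intro: PI_op_to_Rn_bounded)
  have bD: "bounded_op (Rn nw) (Rn ny) ((*\<^sub>v) D21)"
    using D21 by (rule mat_mult_bounded)
  have saP: "selfadjoint_op H P"
    using coerc by (simp add: loewner_le_def)
  note sym = selfadjoint_op_symmetric[OF HS saP]
  note coercive = coercive_of_loewner_le[OF H.semi_inner_space_axioms coerc]
  have P_nonneg: "0 \<le> hinner H y (P y)" if "y \<in> hcarrier H" for y
    using coercive[OF that] H.inner_ge_zero[OF that] eps
    by (meson mult_nonneg_nonneg less_imp_le order_trans)
  note inv = op_inv_exists[OF HS saP eps coercive]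
  have L_comp: "bounded_op (Rn ny) H L"
    unfolding L
    by (rule bounded_op_comp[OF Y.semi_inner_space_axioms HH.semi_inner_pair_axioms bZ])
      (use inv in blast)
  have PL: "heq H (P (L y)) (Z y)" if "y \<in> hcarrier (Rn ny)" for y
    using inv bounded_op_closed[OF bZ that] by (simp add: L op_eq_def)
  have bG: "bounded_op (Rn nw) H G"
    unfolding G
    by (intro UH.bounded_op_add bounded_op_comp[OF U.semi_inner_space_axioms _ bB1 bP]
        bounded_op_comp[OF U.semi_inner_space_axioms _ bD bZ] HH.semi_inner_pair_axioms
        YH.semi_inner_pair_axioms)
  note cl = bounded_op_closed[OF bT] bounded_op_closed[OF bA] bounded_op_closed[OF bP]
    bounded_op_closed[OF bZ] bounded_op_closed[OF bC1] bounded_op_closed[OF bC2]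
    bounded_op_closed[OF L_comp] bounded_op_closed[OF bB1] bounded_op_closed[OF bG]
    bounded_op_closed[OF bD]
  let ?B = "op_neg H (B1 \<boxplus>\<^bsub>H\<^esub> L \<circ> (*\<^sub>v) D21)"
  have form: "0 \<le> hinner H y (P y) - 2 * hinner H y (G u) + scalar_prod u (W *\<^sub>v u)"
    if "y \<in> hcarrier H" "u \<in> carrier_vec nw" for y u
  proof -
    have "0 \<le> hinner H y (P y) - 2 * hinner H y (G u) + hinner (Rn nw) u (W *\<^sub>v u)"
      by (rule block_op_nonneg_form[OF HS hilbert_space_Rn bP bG _ block])
        (use that W in \<open>auto simp: Rn_def\<close>)
    then show ?thesis
      by (simp add: Rn_def)
  qed
  \<comment> \<open>At the zero vector of the space only the lower right block contributes.\<close>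
  have W_psd: "0 \<le> scalar_prod u (W *\<^sub>v u)" if "u \<in> carrier_vec nw" for u
    using form[OF H.zero_closed that] cl that by (simp add: Rn_def)
  have initial: "hinner H (?B u) (P (?B u)) \<le> scalar_prod u (W *\<^sub>v u)"
    and B_closed: "?B u \<in> hcarrier H"
    if u: "u \<in> carrier_vec nw" for u
  proof -
    have u': "u \<in> hcarrier (Rn nw)"
      using u by (simp add: Rn_def)
    define y where "y = hadd H (B1 u) (L (D21 *\<^sub>v u))"
    have y: "y \<in> hcarrier H"
      using u' cl by (simp add: y_def)
    have By: "?B u = hscale H (- 1) y"
      by (simp add: y_def op_neg_def op_scale_def op_add_def)
    then show "?B u \<in> hcarrier H"
      using y by simp
    \<comment> \<open>$Py = Gu$, because $P L = Z$; so the block form at $(y, u)$ collapses to $\langle u, Wu\rangle - \langle y, Py\rangle$.\<close>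
    have "hinner H (P y) y = hinner H (P (B1 u)) y + hinner H (P (L (D21 *\<^sub>v u))) y"
      using u' y cl HH.inner_op_add[OF bP, of "B1 u" "L (D21 *\<^sub>v u)" y] by (simp add: y_def)
    also have "hinner H (P (L (D21 *\<^sub>v u))) y = hinner H (Z (D21 *\<^sub>v u)) y"
      using u' y cl PL by (intro H.heq_inner_left) auto
    also have "hinner H (P (B1 u)) y + \<dots> = hinner H (G u) y"
      using u' y cl by (simp add: G op_add_def)
    finally have "hinner H y (G u) = hinner H y (P y)"
      using u' y cl H.inner_commute by metis
    moreover have "hinner H (?B u) (P (?B u)) = hinner H y (P y)"
      using y cl HH.inner_op_scale[OF bP y, of "hscale H (- 1) y" "- 1"]
        sym[of "hscale H (- 1) y" "hscale H (- 1) y"] sym[of y y]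
      unfolding By by simp
    ultimately show "hinner H (?B u) (P (?B u)) \<le> scalar_prod u (W *\<^sub>v u)"
      using form[OF y u] by simp
  qed
  \<comment> \<open>Zero input enters the dynamics as the value of the input operator at 0, which is only a null vector.\<close>
  have B_zero: "hinner H (?B (0\<^sub>v nw)) y = 0" if y: "y \<in> hcarrier H" for y
  proof -
    have zero: "hzero (Rn nw) = 0\<^sub>v nw" "hzero (Rn ny) = 0\<^sub>v ny" "D21 *\<^sub>v 0\<^sub>v nw = 0\<^sub>v ny"
      using D21 by (auto simp: Rn_def)
    have "hinner H (B1 (0\<^sub>v nw)) y = 0" "hinner H (L (0\<^sub>v ny)) y = 0"
      using UH.inner_op_zero[OF bB1 y] YH.inner_op_zero[OF L_comp y] by (simp_all add: zero)
    moreover have "B1 (0\<^sub>v nw) \<in> hcarrier H" "L (0\<^sub>v ny) \<in> hcarrier H"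
      using cl U.zero_closed Y.zero_closed by (simp_all add: zero)
    ultimately show ?thesis
      using y by (simp add: op_neg_def op_scale_def op_add_def zero)
  qed
  have "L2_norm z \<le> ennreal \<gamma>"
    if u0: "u0 \<in> carrier_vec nw" and unit: "hnorm (Rn nw) u0 = 1"
      and sol: "impulse_solution H nw nz T (A \<boxplus>\<^bsub>H\<^esub> L \<circ> C2) ?B C1 u0 e z" for u0 e z
  proof -
    have e: "e t \<in> hcarrier H" if "t \<ge> 0" for t
      using sol that by (simp add: impulse_solution_def PIE_solution_def)
    have z_L2: "z \<in> L2 0 S nz" if "S \<ge> 0" for S
      using sol that by (simp add: impulse_solution_def PIE_solution_def L2e_def)
    have z_eq: "z t = C1 (e t)" if "t \<ge> 0" for t
    proof -
      have "z t = C1 (e t) + 0\<^sub>m nz nw *\<^sub>v 0\<^sub>v nw"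
        using sol that by (simp add: impulse_solution_def PIE_solution_def)
      moreover have "C1 (e t) \<in> carrier_vec nz"
        using cl(5)[OF e[OF that]] by (simp add: Rn_def)
      moreover have "0\<^sub>m nz nw *\<^sub>v 0\<^sub>v nw = (0\<^sub>v nz :: rvec)"
        by (intro eq_vecI) auto
      ultimately show ?thesis by simp
    qed
    have start: "heq H (T (e 0)) (?B u0)"
      using sol by (simp add: impulse_solution_def PIE_solution_def)
    have "\<forall>t\<in>{0..}. \<exists>v. has_hderiv H (\<lambda>\<tau>. T (e \<tau>)) v t \<and>
        heq H v (hadd H ((A \<boxplus>\<^bsub>H\<^esub> L \<circ> C2) (e t)) (?B (0\<^sub>v nw)))"
      using sol by (simp add: impulse_solution_def PIE_solution_def)
    then obtain v where v: "\<And>t. t \<ge> 0 \<Longrightarrow> has_hderiv H (\<lambda>\<tau>. T (e \<tau>)) (v t) t"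
      and v_eq: "\<And>t. t \<ge> 0 \<Longrightarrow> heq H (v t) (hadd H ((A \<boxplus>\<^bsub>H\<^esub> L \<circ> C2) (e t)) (?B (0\<^sub>v nw)))"
      unfolding bchoice_iff by auto
    define V where "V t = hinner H (T (e t)) (P (T (e t)))" for t
    define V' where "V' t = 2 * hinner H (v t) (P (T (e t)))" for t
    define \<zeta> where "\<zeta> t = scalar_prod (z t) (z t)" for t
    have deriv: "(V has_real_derivative V' t) (at t within {0..})" if "t \<ge> 0" for t
      unfolding V_def[abs_def] V'_def
      by (rule has_hderiv_quadratic_form[OF H.semi_inner_space_axioms bP sym _ v[OF that] that])
        (use e cl in auto)
    have dissipation: "V' t + \<zeta> t \<le> 0" if t: "t \<ge> 0" for t
    proof -
      have v_cl: "v t \<in> hcarrier H"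
        using v[OF t] by (simp add: has_hderiv_def)
      have "hinner H (v t) (P (T (e t)))
          = hinner H (hadd H ((A \<boxplus>\<^bsub>H\<^esub> L \<circ> C2) (e t)) (?B (0\<^sub>v nw))) (P (T (e t)))"
        using v_cl e[OF t] cl B_closed[of "0\<^sub>v nw"]
        by (intro H.heq_inner_left[OF v_eq[OF t]]) (auto simp: op_add_def)
      also have "\<dots> = hinner H (hadd H (A (e t)) (L (C2 (e t)))) (P (T (e t)))"
        using e[OF t] cl B_closed[of "0\<^sub>v nw"] B_zero by (simp add: op_add_def[of A])
      finally have "V' t = 2 * hinner H (hadd H (A (e t)) (L (C2 (e t)))) (P (T (e t)))"
        by (simp add: V'_def)
      moreover have "\<zeta> t = hinner (Rn nz) (C1 (e t)) (C1 (e t))"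
        using t by (simp add: \<zeta>_def z_eq Rn_def)
      moreover have "2 * hinner H (hadd H (A (e t)) (L (C2 (e t)))) (P (T (e t)))
          + hinner (Rn nz) (C1 (e t)) (C1 (e t)) \<le> 0"
        using bounded_op_closed[OF L_comp] PL e[OF t]
        by (intro observer_dissipation[OF HS hilbert_space_Rn hilbert_space_Rn bT bA saP bZ bC2 bC1
              _ _ lmi])
      ultimately show ?thesis by simp
    qed
    have int: "integrable (lebesgue_on {0..S}) \<zeta>" if "S \<ge> 0" for S
      unfolding \<zeta>_def by (rule L2_scalar_prod_integrable[OF z_L2 z_L2, OF that that])
    have V_nonneg: "0 \<le> V t" if "t \<ge> 0" for t
      unfolding V_def using e[OF that] cl by (intro P_nonneg) auto
    have \<zeta>_nonneg: "0 \<le> \<zeta> t" for t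
      by (simp add: \<zeta>_def scalar_prod_self_nonneg)
    note output_energy = integral_le_of_dissipation[OF deriv V_nonneg \<zeta>_nonneg dissipation int]
    have "V 0 = hinner H (?B u0) (P (?B u0))"
    proof -
      have Te: "T (e 0) \<in> hcarrier H"
        using e cl by simp
      have "V 0 = hinner H (?B u0) (P (T (e 0)))"
        unfolding V_def using start Te B_closed[OF u0] cl by (intro H.heq_inner_left) auto
      also have "\<dots> = hinner H (P (?B u0)) (T (e 0))"
        using sym[OF B_closed[OF u0] Te] by simp
      also have "\<dots> = hinner H (P (?B u0)) (?B u0)"
        using start Te B_closed[OF u0] cl by (intro H.heq_inner_right) auto
      also have "\<dots> = hinner H (?B u0) (P (?B u0))"
        using B_closed[OF u0] by (intro sym)
      finally show ?thesis .
    qed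
    also have "\<dots> \<le> scalar_prod u0 (W *\<^sub>v u0)"
      by (rule initial[OF u0])
    also have "\<dots> \<le> mat_trace W * scalar_prod u0 u0"
      by (rule psd_quadratic_form_le_trace[OF W W_psd u0])
    also have "scalar_prod u0 u0 = 1"
      using unit by (simp add: hnorm_def Rn_def)
    finally have "V 0 \<le> \<gamma>\<^sup>2"
      using trace by simp
    then have "sqrt (\<integral>t. \<zeta> t \<partial>lebesgue_on {0..}) \<le> \<gamma>"
      using output_energy(2) gam by (intro real_le_lsqrt) auto
    then show ?thesis
      using output_energy(1) by (auto simp: L2_norm_def \<zeta>_def[abs_def] intro!: ennreal_leI)
  qed
  then show ?thesis
    unfolding H2_norm_def by (intro Sup_least) blast
qed

end
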